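(* Let $n,d\ge 1$ and $T>0$. Assume that $V$ is continuously embedded in $C^1_0(\mathbb{R}^d,\mathbb{R}^d)$ and that its reproducing kernel $K_V$ is $C^2$ in each of its variables. Then for any $u\in L^2([0,T],\mathbb{R}^{nd})$ and any initial condition $q_0=(x_0,p_0)\in\mathbb{R}^{nd}\times\mathbb{R}^{nd}$, there exists $q=(x,p)\in C([0,T],\mathbb{R}^{nd}\times\mathbb{R}^{nd})$ such that for all $t\in[0,T]$ $$x_t=x_0+\int_0^t \partial_pH_0(x_s,p_s)\,ds,\qquad p_t=p_0+\int_0^t\big(-\partial_xH_0(x_s,p_s)+u_s\big)\,ds .$$ Moreover, there exist constants $C_1,C_2,C_3>0$, independent of $u$ and $q_0$, such that for any $t\le T$: (1) $H_0(x_t,p_t)\le \tilde H_T$, where $\tilde H_T:= C_1\big(H_0(x_0,p_0)+T\int_0^T|u_s|^2ds\big)$; (2) $|x_t|\le |x_0|+C_2\,T\,\tilde H_T^{1/2}$; (3) $|p_t|\le \big(|p_0|+\int_0^T|u_s|\,ds\big)\exp\big(C_3\,T\,\tilde H_T^{1/2}\big)$.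
   Context: $V$ is a Hilbert space of vector fields $\mathbb{R}^d\to\mathbb{R}^d$. $C^1_0(\mathbb{R}^d,\mathbb{R}^d)$ is the space of $C^1$ vector fields vanishing at infinity, with norm $|v|_{1,\infty}$ (sup norm of $v$ and its first derivatives); continuous embedding means there is a constant $C$ with $|v|_{1,\infty}\le C|v|_V$ for all $v\in V$. Then $V$ is a reproducing kernel Hilbert space with matrix-valued kernel $K_V:\mathbb{R}^d\times\mathbb{R}^d\to\mathcal{M}_d(\mathbb{R})$, characterized by: for all $z',\alpha'\in\mathbb{R}^d$, $K_V(\cdot,z')\alpha'\in V$ and $\langle v,K_V(\cdot,z')\alpha'\rangle_V=v(z')^T\alpha'$ for all $v\in V$. For $x=(x_1,\dots,x_n)$, $p=(p_1,\dots,p_n)\in(\mathbb{R}^d)^n=\mathbb{R}^{nd}$, $$H_0(x,p)=\tfrac12\sum_{i,j=1}^n p_i^TK_V(x_i,x_j)p_j,$$ with partial gradients $\partial_xH_0,\partial_pH_0\in\mathbb{R}^{nd}$. $|\cdot|$ denotes the Euclidean norm. *)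

theory Defs
  imports "HOL-Analysis.Analysis"
begin

definition C1_map :: "('a::real_normed_vector \<Rightarrow> 'b::real_normed_vector) \<Rightarrow> bool" where
  "C1_map f \<longleftrightarrow>
     (\<exists>f' :: 'a \<Rightarrow> 'a \<Rightarrow>\<^sub>L 'b.
        (\<forall>x. (f has_derivative blinfun_apply (f' x)) (at x)) \<and> continuous_on UNIV f')"

definition C2_map :: "('a::real_normed_vector \<Rightarrow> 'b::real_normed_vector) \<Rightarrow> bool" where
  "C2_map f \<longleftrightarrow>
     (\<exists>f' :: 'a \<Rightarrow> 'a \<Rightarrow>\<^sub>L 'b.
        (\<forall>x. (f has_derivative blinfun_apply (f' x)) (at x)) \<and> C1_map f')"

(* The boundedness of the derivative makes the norm below finite; v itself is bounded because
   it is continuous and vanishes at infinity.  The derivative is not required to vanish. *)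
definition C1_vanishing :: "('a::euclidean_space \<Rightarrow> 'a) set" where
  "C1_vanishing =
     {v. C1_map v \<and> (v \<longlongrightarrow> 0) at_infinity \<and>
         bdd_above (range (\<lambda>z. onorm (frechet_derivative v (at z))))}"

definition norm_1_inf :: "('a::euclidean_space \<Rightarrow> 'a) \<Rightarrow> real" where
  "norm_1_inf v =
     (SUP z. norm (v z)) + (SUP z. onorm (frechet_derivative v (at z)))"

(* A Hilbert space of vector fields: an abstract Hilbert space 'v whose elements are identified
   with vector fields through ev, where ev v z is the value of the field v at z.  Linearity says
   that the vector space operations are the pointwise ones; injectivity, that an element is
   determined by the field it stands for. *)
definition vector_field_space ::
    "('v::{real_inner,complete_space} \<Rightarrow> 'a::euclidean_space \<Rightarrow> 'a) \<Rightarrow> bool" where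
  "vector_field_space ev \<longleftrightarrow> (\<forall>z. linear (\<lambda>v. ev v z)) \<and> inj ev"

definition continuously_embedded_C1 ::
    "('v::{real_inner,complete_space} \<Rightarrow> 'a::euclidean_space \<Rightarrow> 'a) \<Rightarrow> bool" where
  "continuously_embedded_C1 ev \<longleftrightarrow>
     range ev \<subseteq> C1_vanishing \<and> (\<exists>C. \<forall>v. norm_1_inf (ev v) \<le> C * norm v)"

definition reproducing_kernel ::
    "('v::{real_inner,complete_space} \<Rightarrow> real^'d \<Rightarrow> real^'d) \<Rightarrow>
     (real^'d \<Rightarrow> real^'d \<Rightarrow> real^'d^'d) \<Rightarrow> bool" where
  "reproducing_kernel ev K \<longleftrightarrow>
     (\<forall>z' \<alpha>'. \<exists>k. ev k = (\<lambda>z. K z z' *v \<alpha>') \<and> (\<forall>v. v \<bullet> k = ev v z' \<bullet> \<alpha>'))"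

definition C2_in_each_variable ::
    "('a::real_normed_vector \<Rightarrow> 'a \<Rightarrow> 'b::real_normed_vector) \<Rightarrow> bool" where
  "C2_in_each_variable K \<longleftrightarrow>
     (\<forall>y. C2_map (\<lambda>x. K x y)) \<and> (\<forall>x. C2_map (\<lambda>y. K x y))"

definition hamiltonian ::
    "(real^'d \<Rightarrow> real^'d \<Rightarrow> real^'d^'d) \<Rightarrow> real^'d^'n \<Rightarrow> real^'d^'n \<Rightarrow> real" where
  "hamiltonian K x p = 1/2 * (\<Sum>i\<in>UNIV. \<Sum>j\<in>UNIV. p $ i \<bullet> (K (x $ i) (x $ j) *v p $ j))"

definition gradient :: "('a::real_inner \<Rightarrow> real) \<Rightarrow> 'a \<Rightarrow> 'a" where
  "gradient f x = (THE D. GDERIV f x :> D)"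

definition L2_control :: "real \<Rightarrow> (real \<Rightarrow> 'a::euclidean_space) set" where
  "L2_control T =
     {u. u \<in> borel_measurable (lebesgue_on {0..T}) \<and>
         integrable (lebesgue_on {0..T}) (\<lambda>s. (norm (u s))\<^sup>2)}"

(* The integrability conditions keep the integrals from taking their default value 0. *)
definition controlled_hamiltonian_solution ::
    "(real^'d \<Rightarrow> real^'d \<Rightarrow> real^'d^'d) \<Rightarrow> real \<Rightarrow> (real \<Rightarrow> real^'d^'n) \<Rightarrow>
     real^'d^'n \<Rightarrow> real^'d^'n \<Rightarrow> (real \<Rightarrow> real^'d^'n) \<Rightarrow> (real \<Rightarrow> real^'d^'n) \<Rightarrow> bool" where
  "controlled_hamiltonian_solution K T u x0 p0 x p \<longleftrightarrow>
     continuous_on {0..T} (\<lambda>t. (x t, p t)) \<and>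
     (\<forall>t\<in>{0..T}.
        integrable (lebesgue_on {0..t}) (\<lambda>s. gradient (\<lambda>p'. hamiltonian K (x s) p') (p s)) \<and>
        x t = x0 + (LINT s|lebesgue_on {0..t}. gradient (\<lambda>p'. hamiltonian K (x s) p') (p s)) \<and>
        integrable (lebesgue_on {0..t})
          (\<lambda>s. - gradient (\<lambda>x'. hamiltonian K x' (p s)) (x s) + u s) \<and>
        p t = p0 + (LINT s|lebesgue_on {0..t}.
                      - gradient (\<lambda>x'. hamiltonian K x' (p s)) (x s) + u s))"

end

theory Submission
  imports Defs "HOL-Complex_Analysis.Great_Picard"
begin

text \<open>With \<open>v = \<Sum>\<^sub>j K(\<cdot>, x\<^sub>j) p\<^sub>j\<close> in the Hilbert space, \<open>H\<^sub>0(x, p) = |v|\<^sup>2 / 2\<close>, so the embedding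
  bounds \<open>\<partial>\<^sub>p H\<^sub>0\<close> by \<open>c \<surd>H\<^sub>0\<close> and \<open>\<partial>\<^sub>x H\<^sub>0\<close> by \<open>c \<surd>H\<^sub>0 |p|\<close>, and already makes \<open>H\<^sub>0\<close> jointly \<open>C\<^sup>1\<close>.
  Along a trajectory only the control changes \<open>H\<^sub>0\<close>, whence \<open>\<surd>H\<^sub>0\<close> grows at most at rate \<open>c |u| / 2\<close>;
  the bounds on \<open>x\<close> and, by Gronwall, on \<open>p\<close> follow. The substitution \<open>p = P + \<integral>u\<close> turns the
  equation into one with a continuous right-hand side, which has a solution by Peano's theorem; the
  a priori bounds make it global.\<close>

subsection \<open>Peano's theorem\<close>

text \<open>Peano rather than Picard: \<open>\<partial>\<^sub>x H\<^sub>0\<close> contains the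
  derivative of the velocity field, for which the embedding gives a sup bound and continuity, but no
  Lipschitz estimate. Existence therefore rests on compactness. Since this gives no uniqueness, the
  a priori bounds are proved for every solution on every initial segment [0, \<tau>], not for one
  chosen solution. The other obstacle is the control: with \<open>u\<close> merely integrable,
  \<open>p\<close> need not be differentiable at every time, so the energy along a trajectory cannot
  simply be differentiated. Formally its derivative is \<open>\<partial>\<^sub>p H\<^sub>0\<close>
  paired with \<open>u\<close>, at most c |u| sqrt H; dividing by 2 sqrt H gives the rate c |u| / 2.
  Passing to the root turns this into an estimate that sees only the integral of |u|; squaring it
  and applying Cauchy-Schwarz produces the form of the energy bound.\<close>

lemma integral_diff_bound:
  fixes h :: "real \<Rightarrow> 'a::euclidean_space"
  assumes h: "h integrable_on {0..T}" and B: "\<And>s. s \<in> {0..T} \<Longrightarrow> norm (h s) \<le> B"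
    and st: "s \<in> {0..T}" "t \<in> {0..T}"
  shows "norm (integral {0..t} h - integral {0..s} h) \<le> B * \<bar>t - s\<bar>"
proof -
  have *: "norm (integral {0..b} h - integral {0..a} h) \<le> B * (b - a)"
    if ab: "0 \<le> a" "a \<le> b" "b \<le> T" for a b
  proof -
    have i: "h integrable_on {0..b}" "h integrable_on {a..b}"
      using ab by (auto intro!: integrable_on_subinterval[OF h])
    have "integral {0..a} h + integral {a..b} h = integral {0..b} h"
      using ab i by (intro Henstock_Kurzweil_Integration.integral_combine) auto
    then have "integral {0..b} h - integral {0..a} h = integral {a..b} h"
      by (simp add: algebra_simps)
    moreover have "norm (integral (cbox a b) h) \<le> B * measure lborel (cbox a b)"
      using ab i B order_trans[OF norm_ge_zero B[of a]]
      by (intro has_integral_bound[OF _ integrable_integral]) (auto simp: cbox_interval)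
    ultimately show ?thesis using ab by (simp add: cbox_interval)
  qed
  show ?thesis
  proof (cases "s \<le> t")
    case True then show ?thesis using *[of s t] st by auto
  next
    case False then show ?thesis using *[of t s] st by (auto simp: norm_minus_commute)
  qed
qed

text \<open>Method of steps: the integrand at time s sees \<open>q\<close> only at time s -
  \<delta>, clamped at 0. Hence the iterates of the integral operator \<open>\<Phi>\<close> no
  longer change up to time m \<delta> after m rounds, and finitely many rounds cover [0, T]. No
  contraction is involved.\<close>

lemma delayed_ode_exists:
  fixes f :: "real \<Rightarrow> 'a::euclidean_space \<Rightarrow> 'a"
  assumes T: "0 \<le> T" and \<delta>: "0 < \<delta>"
    and f: "continuous_on ({0..T} \<times> UNIV) (\<lambda>z. f (fst z) (snd z))"
  obtains q where "continuous_on {0..T} q"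
    "\<And>t. t \<in> {0..T} \<Longrightarrow> q t = q0 + integral {0..t} (\<lambda>s. f s (q (max 0 (s - \<delta>))))"
proof -
  define \<Phi> where "\<Phi> q t = q0 + integral {0..t} (\<lambda>s. f s (q (max 0 (s - \<delta>))))" for q t
  define g where "g m = (\<Phi> ^^ m) (\<lambda>_. q0)" for m
  have g_Suc: "g (Suc m) = \<Phi> (g m)" for m by (simp add: g_def)
  have cont: "continuous_on {0..T} (g m)" for m
  proof (induction m)
    case 0 then show ?case by (simp add: g_def)
  next
    case (Suc m)
    have "continuous_on {0..T} (\<lambda>s. g m (max 0 (s - \<delta>)))"
      using \<delta> by (intro continuous_on_compose2[OF Suc.IH] continuous_intros) auto
    then have "continuous_on {0..T} (\<lambda>s. f s (g m (max 0 (s - \<delta>))))"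
      by (intro continuous_on_compose2[OF f, of _ "\<lambda>s. (s, g m (max 0 (s - \<delta>)))", simplified]
          continuous_intros) auto
    then show ?case unfolding g_Suc \<Phi>_def
      by (intro continuous_intros indefinite_integral_continuous_1 integrable_continuous_real)
  qed
  have stab: "g (Suc m) t = g m t" if "t \<in> {0..T}" "t \<le> m * \<delta>" for m t
    using that
  proof (induction m arbitrary: t)
    case 0 then show ?case by (simp add: g_Suc \<Phi>_def) (simp add: g_def)
  next
    case (Suc m)
    have "g (Suc m) (max 0 (s - \<delta>)) = g m (max 0 (s - \<delta>))" if "s \<in> {0..t}" for s
      using that Suc.prems \<delta> by (intro Suc.IH) (auto simp: algebra_simps)
    then have "integral {0..t} (\<lambda>s. f s (g (Suc m) (max 0 (s - \<delta>))))
        = integral {0..t} (\<lambda>s. f s (g m (max 0 (s - \<delta>))))"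
      by (intro Henstock_Kurzweil_Integration.integral_cong) simp
    then show ?case by (simp only: g_Suc[of "Suc m"] g_Suc[of m] \<Phi>_def)
  qed
  obtain m :: nat where m: "T \<le> m * \<delta>"
    using reals_Archimedean3[OF \<delta>] less_imp_le by blast
  show thesis
  proof (rule that[OF cont[of m]])
    fix t assume "t \<in> {0..T}"
    then show "g m t = q0 + integral {0..t} (\<lambda>s. f s (g m (max 0 (s - \<delta>))))"
      using stab[of t m] m by (simp only: g_Suc \<Phi>_def) simp
  qed
qed

text \<open>Tonelli's argument: solutions of the delayed equations are equi-Lipschitz, and a uniform
  limit as the delay tends to 0 solves the equation.\<close>

lemma peano_bounded:
  fixes f :: "real \<Rightarrow> 'a::euclidean_space \<Rightarrow> 'a"
  assumes T: "0 \<le> T"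
    and f: "continuous_on ({0..T} \<times> UNIV) (\<lambda>z. f (fst z) (snd z))"
    and B: "\<And>s x. s \<in> {0..T} \<Longrightarrow> norm (f s x) \<le> B"
  obtains q where "continuous_on {0..T} q"
    "\<And>t. t \<in> {0..T} \<Longrightarrow> q t = q0 + integral {0..t} (\<lambda>s. f s (q s))"
proof -
  have cont_f: "continuous_on {0..T} (\<lambda>s. f s (y s))" if "continuous_on {0..T} y" for y
    using that by (intro continuous_on_compose2[OF f, of _ "\<lambda>s. (s, y s)", simplified]
          continuous_intros) auto
  have B0: "0 \<le> B" using order_trans[OF norm_ge_zero B[of 0 0]] T by simp
  define \<delta> where "\<delta> n = inverse (real (Suc n))" for n
  have \<delta>: "0 < \<delta> n" for n by (simp add: \<delta>_def)
  have "\<forall>n. \<exists>q. continuous_on {0..T} q \<and>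
    (\<forall>t\<in>{0..T}. q t = q0 + integral {0..t} (\<lambda>s. f s (q (max 0 (s - \<delta> n)))))"
    by (metis delayed_ode_exists[OF T \<delta> f])
  then obtain q where q_cont: "\<And>n. continuous_on {0..T} (q n)"
    and q: "\<And>n t. t \<in> {0..T} \<Longrightarrow>
      q n t = q0 + integral {0..t} (\<lambda>s. f s (q n (max 0 (s - \<delta> n))))"
    by metis
  have cont_fq: "continuous_on {0..T} (\<lambda>s. f s (q n (max 0 (s - \<delta> n))))" for n
    using \<delta>[of n]
    by (intro cont_f continuous_on_compose2[OF q_cont[of n]] continuous_intros) auto
  have Lip: "norm (q n t - q n s) \<le> B * \<bar>t - s\<bar>" if "s \<in> {0..T}" "t \<in> {0..T}" for n s t
    using integral_diff_bound[OF integrable_continuous_real[OF cont_fq[of n]] B that] that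
    by (simp add: q)
  have bnd: "norm (q n t) \<le> norm q0 + B * T" if "t \<in> {0..T}" for n t
  proof -
    have "norm (q n t - q0) \<le> B * \<bar>t\<bar>" using Lip[of 0 t n] that T q[of 0 n] by simp
    also have "\<dots> \<le> B * T" using that B0 by (intro mult_left_mono) auto
    finally show ?thesis using norm_triangle_sub[of "q n t" q0] by linarith
  qed
  obtain g k where g: "continuous_on {0..T} g" and k: "strict_mono (k :: nat \<Rightarrow> nat)"
    and lim: "\<And>e. 0 < e \<Longrightarrow> \<exists>N. \<forall>n x. n \<ge> N \<and> x \<in> {0..T} \<longrightarrow> norm (q (k n) x - g x) < e"
  proof (rule Arzela_Ascoli[of "{0..T}" q "norm q0 + B * T"])
    fix x e :: real assume "x \<in> {0..T}" "0 < e"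
    \<comment> \<open>Dividing by \<open>B + 1\<close> rather than \<open>B\<close> allows for
      \<open>B = 0\<close>.\<close>
    moreover have "B * \<bar>x - y\<bar> < e" if "\<bar>x - y\<bar> < e / (B + 1)" for y
    proof -
      have "B * \<bar>x - y\<bar> \<le> (B + 1) * \<bar>x - y\<bar>" by (simp add: algebra_simps)
      also have "\<dots> < e" using that B0 by (simp add: field_simps)
      finally show ?thesis .
    qed
    ultimately show "\<exists>d>0. \<forall>n y. y \<in> {0..T} \<and> norm (x - y) < d \<longrightarrow> norm (q n x - q n y) < e"
      using B0 by (intro exI[of _ "e / (B + 1)"] conjI allI impI order_le_less_trans[OF Lip]) auto
  qed (use bnd in auto)
  have limq: "(\<lambda>n. q (k n) t) \<longlonglongrightarrow> g t" if "t \<in> {0..T}" for t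
    unfolding LIMSEQ_iff using lim that by blast
  have lim\<delta>: "(\<lambda>n. \<delta> (k n)) \<longlonglongrightarrow> 0"
    using LIMSEQ_subseq_LIMSEQ[OF LIMSEQ_inverse_real_of_nat k] by (simp add: \<delta>_def o_def)
  \<comment> \<open>By the common Lipschitz bound the delay shifts the value by at most
    \<open>B * \<delta> (k n)\<close>, so delayed and undelayed values have the same limit.\<close>
  have limd: "(\<lambda>n. q (k n) (max 0 (t - \<delta> (k n)))) \<longlonglongrightarrow> g t" if t: "t \<in> {0..T}" for t
  proof -
    have "norm (q (k n) (max 0 (t - \<delta> (k n))) - q (k n) t) \<le> B * \<delta> (k n)" for n
    proof -
      have "norm (q (k n) (max 0 (t - \<delta> (k n))) - q (k n) t)
          \<le> B * \<bar>max 0 (t - \<delta> (k n)) - t\<bar>"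
        using t \<delta>[of "k n"] by (intro Lip) auto
      also have "\<dots> \<le> B * \<delta> (k n)"
        using t \<delta>[of "k n"] B0 by (intro mult_left_mono) auto
      finally show ?thesis .
    qed
    then have "(\<lambda>n. q (k n) (max 0 (t - \<delta> (k n))) - q (k n) t) \<longlonglongrightarrow> 0"
      by (intro Lim_null_comparison[OF _ tendsto_mult_right_zero[OF lim\<delta>, of B]]) auto
    from tendsto_add[OF this limq[OF t]] show ?thesis by simp
  qed
  show thesis
  proof (rule that[OF g])
    fix t assume t: "t \<in> {0..T}"
    have "(\<lambda>n. integral {0..t} (\<lambda>s. f s (q (k n) (max 0 (s - \<delta> (k n))))))
        \<longlonglongrightarrow> integral {0..t} (\<lambda>s. f s (g s))"
    proof (rule dominated_convergence(2)[where h = "\<lambda>_. B"])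
      show "(\<lambda>s. f s (q (k n) (max 0 (s - \<delta> (k n))))) integrable_on {0..t}" for n
        using t by (intro integrable_continuous_real continuous_on_subset[OF cont_fq]) auto
      show "norm (f s (q (k n) (max 0 (s - \<delta> (k n))))) \<le> B" if "s \<in> {0..t}" for n s
        using B that t by auto
      fix s assume s: "s \<in> {0..t}"
      then have "continuous_on UNIV (f s)"
        using t by (intro continuous_on_compose2[OF f, of _ "\<lambda>y. (s, y)", simplified]
          continuous_intros) auto
      then show "(\<lambda>n. f s (q (k n) (max 0 (s - \<delta> (k n))))) \<longlonglongrightarrow> f s (g s)"
        using s t by (intro continuous_on_tendsto_compose[OF _ limd]) auto
    qed auto
    then have "(\<lambda>n. q0 + integral {0..t} (\<lambda>s. f s (q (k n) (max 0 (s - \<delta> (k n))))))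
        \<longlonglongrightarrow> q0 + integral {0..t} (\<lambda>s. f s (g s))"
      by (intro tendsto_intros)
    then have "(\<lambda>n. q (k n) t) \<longlonglongrightarrow> q0 + integral {0..t} (\<lambda>s. f s (g s))"
      using q[OF t] by simp
    then show "g t = q0 + integral {0..t} (\<lambda>s. f s (g s))"
      using limq[OF t] LIMSEQ_unique by blast
  qed
qed

text \<open>Composing \<open>f\<close> with the projection onto a ball of radius R > M makes it
  bounded, so a solution of the modified equation exists on all of [0, T]. It never leaves the ball:
  up to the first time with norm at least R it solves the original equation, and the a priori bound
  gives norm at most M < R there.\<close>

lemma peano_apriori:
  fixes f :: "real \<Rightarrow> 'a::euclidean_space \<Rightarrow> 'a"
  assumes T: "0 \<le> T"
    and f: "continuous_on ({0..T} \<times> UNIV) (\<lambda>z. f (fst z) (snd z))"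
    and apriori: "\<And>\<tau> q. \<lbrakk>\<tau> \<in> {0..T}; continuous_on {0..\<tau>} q;
        \<And>t. t \<in> {0..\<tau>} \<Longrightarrow> q t = q0 + integral {0..t} (\<lambda>s. f s (q s))\<rbrakk> \<Longrightarrow> norm (q \<tau>) \<le> M"
  obtains q where "continuous_on {0..T} q"
    "\<And>t. t \<in> {0..T} \<Longrightarrow> q t = q0 + integral {0..t} (\<lambda>s. f s (q s))"
proof -
  define R where "R = \<bar>M\<bar> + 1"
  define pr where "pr = closest_point (cball (0::'a) R)"
  have R: "0 < R" "M < R" by (auto simp: R_def)
  have pr_in: "pr y \<in> cball 0 R" for y
    unfolding pr_def using R by (intro closest_point_in_set) auto
  have pr_id: "pr y = y" if "norm y \<le> R" for y
    unfolding pr_def using that by (intro closest_point_self) auto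
  have pr_cont: "continuous_on UNIV pr"
    unfolding pr_def using R by (intro continuous_on_closest_point) auto
  have f': "continuous_on ({0..T} \<times> UNIV) (\<lambda>z. f (fst z) (pr (snd z)))"
    by (intro continuous_on_compose2[OF f, of _ "\<lambda>z. (fst z, pr (snd z))", simplified]
          continuous_intros continuous_on_compose2[OF pr_cont]) auto
  have "compact ((\<lambda>z. f (fst z) (snd z)) ` ({0..T} \<times> cball 0 R))"
    by (intro compact_continuous_image continuous_on_subset[OF f] compact_Times) auto
  then obtain B where B: "\<And>s y. s \<in> {0..T} \<Longrightarrow> y \<in> cball 0 R \<Longrightarrow> norm (f s y) \<le> B"
    by (force dest!: compact_imp_bounded simp: bounded_iff)
  obtain q where q: "continuous_on {0..T} q"
    "\<And>t. t \<in> {0..T} \<Longrightarrow> q t = q0 + integral {0..t} (\<lambda>s. f s (pr (q s)))"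
    using peano_bounded[OF T f', of B] B pr_in by metis
  \<comment> \<open>The bound is asked only for times strictly before t; the endpoint is a null set.
    This makes the first exit time itself admissible for t.\<close>
  have solves: "q t = q0 + integral {0..t} (\<lambda>s. f s (q s))"
    if "t \<in> {0..T}" "\<And>s. s \<in> {0..<t} \<Longrightarrow> norm (q s) \<le> R" for t
  proof -
    have "integral {0..t} (\<lambda>s. f s (pr (q s))) = integral {0..t} (\<lambda>s. f s (q s))"
      using that by (intro integral_spike[of "{t}"]) (auto simp: pr_id)
    then show ?thesis using q(2)[OF that(1)] by simp
  qed
  have "norm (q t) < R" if t: "t \<in> {0..T}" for t
  proof (rule ccontr)
    assume "\<not> norm (q t) < R"
    define S where "S = {0..T} \<inter> (\<lambda>t. norm (q t)) -` {R..}"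
    have "compact S"
      unfolding S_def compact_eq_bounded_closed
      using continuous_closed_preimage[OF continuous_on_norm[OF q(1)], of "{R..}"]
      by (simp add: bounded_Int)
    moreover have "S \<noteq> {}" using t \<open>\<not> norm (q t) < R\<close> by (auto simp: S_def)
    ultimately obtain \<tau> where \<tau>: "\<tau> \<in> S" "\<And>s. s \<in> S \<Longrightarrow> \<tau> \<le> s"
      using compact_attains_inf by metis
    have lt: "norm (q s) \<le> R" if "s \<in> {0..<\<tau>}" for s
      using \<tau>(2)[of s] \<tau>(1) that by (force simp: S_def)
    have "norm (q \<tau>) \<le> M"
      using \<tau>(1) lt by (intro apriori continuous_on_subset[OF q(1)] solves) (auto simp: S_def)
    then show False using \<tau>(1) R by (auto simp: S_def)
  qed
  then show thesis
    by (intro that[OF q(1)] solves) (auto intro!: less_imp_le)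
qed

subsection \<open>Integral and differential inequalities\<close>

text \<open>The integrating factor is applied to the majorant A + k * integral of y, which is
  differentiable although y need not be.\<close>

lemma gronwall:
  fixes y :: "real \<Rightarrow> real"
  assumes y: "continuous_on {0..\<tau>} y" and k: "0 \<le> k"
    and le: "\<And>t. t \<in> {0..\<tau>} \<Longrightarrow> y t \<le> A + k * integral {0..t} y"
    and \<tau>: "0 \<le> \<tau>"
  shows "y \<tau> \<le> A * exp (k * \<tau>)"
proof -
  define Y where "Y t = (A + k * integral {0..t} y) * exp (- k * t)" for t
  have d: "(Y has_real_derivative k * (y t - (A + k * integral {0..t} y)) * exp (- k * t))
      (at t within {0..\<tau>})" if t: "t \<in> {0..\<tau>}" for t
    unfolding Y_def
    by (auto intro!: derivative_eq_intros integral_has_real_derivative[OF y t] simp: algebra_simps)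
  have "Y \<tau> \<le> Y 0"
  proof (rule DERIV_nonpos_imp_decreasing_open[OF \<tau>])
    fix t assume "0 < t" "t < \<tau>"
    then have "(Y has_real_derivative k * (y t - (A + k * integral {0..t} y)) * exp (- k * t)) (at t)"
      using d[of t] at_within_Icc_at[of 0 t \<tau>] by simp
    moreover have "k * (y t - (A + k * integral {0..t} y)) * exp (- k * t) \<le> 0"
      using le[of t] k \<open>0 < t\<close> \<open>t < \<tau>\<close>
      by (intro mult_nonpos_nonneg mult_nonneg_nonpos) auto
    ultimately show "\<exists>z. (Y has_real_derivative z) (at t) \<and> z \<le> 0" by blast
  next
    show "continuous_on {0..\<tau>} Y" by (rule DERIV_continuous_on[OF d])
  qed
  then have "(A + k * integral {0..\<tau>} y) \<le> A * exp (k * \<tau>)"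
    unfolding Y_def by (simp add: exp_minus divide_simps)
  then show ?thesis using le[of \<tau>] \<tau> by simp
qed

text \<open>Takes the place of the mean value inequality where no derivative is available. Let m be
  the supremum of the times up to which g stays below g a. Continuity carries the bound to m, and
  the local hypothesis at m pushes it further unless m = b.\<close>

lemma locally_nonincreasing_imp_le:
  fixes g :: "real \<Rightarrow> real"
  assumes g: "continuous_on {a..b} g" and ab: "a \<le> b"
    and loc: "\<And>t. a \<le> t \<Longrightarrow> t < b \<Longrightarrow> eventually (\<lambda>s. g s \<le> g t) (at t within {t..b})"
  shows "g b \<le> g a"
proof -
  define S where "S = {t \<in> {a..b}. \<forall>s\<in>{a..t}. g s \<le> g a}"
  have aS: "a \<in> S" and bdd: "bdd_above S" using ab by (auto simp: S_def)
  define m where "m = Sup S"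
  have m: "a \<le> m" "m \<le> b"
  proof -
    show "a \<le> m" unfolding m_def by (rule cSup_upper[OF aS bdd])
    show "m \<le> b" unfolding m_def by (rule cSup_least) (use aS in \<open>auto simp: S_def\<close>)
  qed
  have below: "g s \<le> g a" if "a \<le> s" "s < m" for s
  proof -
    obtain t where "t \<in> S" "s < t" using less_cSup_iff[of S s] aS bdd \<open>s < m\<close> m_def by blast
    then show ?thesis using \<open>a \<le> s\<close> by (simp add: S_def)
  qed
  have gm: "g m \<le> g a"
  proof (cases "a = m")
    case False
    then have am: "a < m" using m by simp
    have "closure {a..<m} = {a..m}" using am by simp
    then show ?thesis
      using continuous_le_on_closure[of "{a..<m}" g m "g a"] continuous_on_subset[OF g] m below by auto
  qed simp
  show ?thesis
  proof (cases "m = b")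
    case False
    then have "m < b" using m by simp
    then obtain d where d: "d > 0" "\<And>s. s \<in> {m..b} \<Longrightarrow> s \<noteq> m \<Longrightarrow> dist s m < d \<Longrightarrow> g s \<le> g m"
      using loc[of m] m by (auto simp: eventually_at)
    define r where "r = min b (m + d / 2)"
    have r: "m < r" "r \<le> b" using \<open>m < b\<close> d by (auto simp: r_def)
    have "g s \<le> g a" if s: "s \<in> {a..r}" for s
    proof (cases s m rule: linorder_cases)
      case less
      then show ?thesis using below s by simp
    next
      case equal
      then show ?thesis using gm by simp
    next
      case greater
      moreover have "s \<le> m + d / 2" using s unfolding r_def by (simp only: atLeastAtMost_iff min.bounded_iff)
      ultimately have "dist s m < d" using d(1) unfolding dist_real_def by linarith
      then have "g s \<le> g m" using greater s r by (intro d(2)) auto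
      then show ?thesis using gm by simp
    qed
    then have "r \<in> S" using r m by (simp add: S_def)
    then have "r \<le> m" using cSup_upper[OF _ bdd, of r] by (simp only: m_def)
    then show ?thesis using r by simp
  next
    case True
    then show ?thesis using gm by simp
  qed
qed

subsection \<open>Controlled Hamiltonian systems\<close>

text \<open>What the dynamics needs from the kernel space. The kernel Hamiltonian is quadratic in p,
  so sqrt H scales like p, its p-gradient like p and its x-gradient like the square of p; the two
  growth bounds have this homogeneity. Once the energy is bounded, the speed of x is bounded and the
  force on p is at most linear in p.\<close>

locale bounded_hamiltonian =
  fixes H :: "'a::euclidean_space \<Rightarrow> 'a \<Rightarrow> real" and Gx Gp :: "'a \<Rightarrow> 'a \<Rightarrow> 'a" and c :: real
  assumes c_pos: "0 < c"
    and has_derivative_H: "\<And>x p. ((\<lambda>z. H (fst z) (snd z)) has_derivative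
          (\<lambda>h. fst h \<bullet> Gx x p + snd h \<bullet> Gp x p)) (at (x, p))"
    and continuous_Gx: "continuous_on UNIV (\<lambda>z. Gx (fst z) (snd z))"
    and continuous_Gp: "continuous_on UNIV (\<lambda>z. Gp (fst z) (snd z))"
    and H_nonneg: "\<And>x p. 0 \<le> H x p"
    and Gp_bound: "\<And>x p. norm (Gp x p) \<le> c * sqrt (H x p)"
    and Gx_bound: "\<And>x p. norm (Gx x p) \<le> c * sqrt (H x p) * norm p"
begin

lemma continuous_on_G:
  assumes "continuous_on S x" "continuous_on S p"
  shows "continuous_on S (\<lambda>s. Gx (x s) (p s))" "continuous_on S (\<lambda>s. Gp (x s) (p s))"
  using continuous_on_compose2[OF continuous_Gx, of S "\<lambda>s. (x s, p s)"]
    continuous_on_compose2[OF continuous_Gp, of S "\<lambda>s. (x s, p s)"] assms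
  by (auto intro: continuous_intros)

lemma continuous_on_H:
  assumes "continuous_on S x" "continuous_on S p"
  shows "continuous_on S (\<lambda>s. H (x s) (p s))"
proof -
  have "continuous_on UNIV (\<lambda>z. H (fst z) (snd z))"
    using has_derivative_continuous[OF has_derivative_H[of "fst z" "snd z" for z]]
    by (intro continuous_at_imp_continuous_on) simp
  from continuous_on_compose2[OF this, of S "\<lambda>s. (x s, p s)"] assms show ?thesis
    by (auto intro: continuous_intros)
qed

text \<open>The Hamiltonian flow itself does not change \<open>H\<close>, so the increments of \<open>sqrt H\<close> come from
  the increments of the control alone, at rate at most \<open>c / 2\<close>. As the control is only integrable,
  this is derived from a comparison of increments on short right intervals rather than from a
  derivative; \<open>\<epsilon>\<close> makes the root differentiable and \<open>e\<close> absorbs the error terms.\<close>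

lemma energy_local:
  fixes x P U :: "real \<Rightarrow> 'a" and W :: "real \<Rightarrow> real"
  assumes e: "0 < e" "e < 1" and \<epsilon>: "0 < \<epsilon>"
    and cont: "continuous_on {0..\<tau>} x" "continuous_on {0..\<tau>} P" "continuous_on {0..\<tau>} U"
    and UW: "\<And>s t. 0 \<le> s \<Longrightarrow> s \<le> t \<Longrightarrow> t \<le> \<tau> \<Longrightarrow> norm (U t - U s) \<le> W t - W s"
    and dx: "\<And>t. t \<in> {0..\<tau>} \<Longrightarrow>
        (x has_vector_derivative Gp (x t) (P t + U t)) (at t within {0..\<tau>})"
    and dP: "\<And>t. t \<in> {0..\<tau>} \<Longrightarrow>
        (P has_vector_derivative - Gx (x t) (P t + U t)) (at t within {0..\<tau>})"
    and t: "0 \<le> t" "t < \<tau>"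
  shows "\<forall>\<^sub>F s in at t within {t..\<tau>}.
      sqrt (H (x s) (P s + U s) + \<epsilon>) - (c / 2 + e) * W s - e * s
      \<le> sqrt (H (x t) (P t + U t) + \<epsilon>) - (c / 2 + e) * W t - e * t"
proof -
  define z where "z s = (x s, P s + U s)" for s
  define \<phi> where "\<phi> y = sqrt (H (fst y) (snd y) + \<epsilon>)" for y
  define a where "a = Gx (x t) (P t + U t)"
  define b where "b = Gp (x t) (P t + U t)"
  define h where "h = H (x t) (P t + U t)"
  define S where "S = sqrt (h + \<epsilon>)"
  define N where "N = norm a + norm b"
  define D where "D y = (fst y \<bullet> a + snd y \<bullet> b) / (2 * S)" for y
  \<comment> \<open>\<open>d\<close> is the tolerance in the first-order expansions of \<phi>, x and
    P. The errors proportional to k = s - t add up to \<open>d * (N / (2 * S) + N + 2) * k\<close>,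
    which this choice makes equal to \<open>e * k\<close>. The summand 2 also yields d \<le> e and d
    \<le> 1.\<close>
  define d where "d = e / (N / (2 * S) + N + 2)"
  have h: "0 \<le> h" by (simp add: h_def H_nonneg)
  then have S: "0 < S" "sqrt h \<le> S" using \<epsilon> by (auto simp: S_def)
  have N: "0 \<le> N" by (simp add: N_def)
  have d: "0 < d" "d \<le> 1" "d \<le> e" "d * (N / (2 * S) + N + 2) = e"
  proof -
    have *: "2 \<le> N / (2 * S) + N + 2" using N S by simp
    then show "0 < d" "d * (N / (2 * S) + N + 2) = e" using e by (auto simp: d_def)
    have "e / (N / (2 * S) + N + 2) \<le> e / 1" using * e by (intro divide_left_mono) auto
    then show "d \<le> e" "d \<le> 1" using e by (auto simp: d_def)
  qed
  have "(\<phi> has_derivative D) (at (z t))"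
    unfolding \<phi>_def D_def S_def h_def a_def b_def z_def using h \<epsilon>
    by (auto intro!: derivative_eq_intros has_derivative_H simp: h_def field_simps)
  then have "eventually (\<lambda>y. norm (\<phi> y - \<phi> (z t) - D (y - z t)) \<le> d * norm (y - z t)) (nhds (z t))"
    using d(1) unfolding has_derivative_at_alt eventually_nhds_metric dist_norm by blast
  moreover have "(z \<longlongrightarrow> z t) (at t within {t..\<tau>})"
  proof -
    have "continuous_on {0..\<tau>} z" unfolding z_def by (intro continuous_intros cont)
    then have "(z \<longlongrightarrow> z t) (at t within {0..\<tau>})" using t by (simp add: continuous_on_def)
    then show ?thesis by (rule tendsto_within_subset) (use t in auto)
  qed
  ultimately have ev\<phi>: "\<forall>\<^sub>F s in at t within {t..\<tau>}.
      norm (\<phi> (z s) - \<phi> (z t) - D (z s - z t)) \<le> d * norm (z s - z t)"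
    by (rule eventually_compose_filterlim)
  have ev_vec: "\<forall>\<^sub>F s in at t within {t..\<tau>}. norm (y s - y t - (s - t) *\<^sub>R v) \<le> d * norm (s - t)"
    if "(y has_vector_derivative v) (at t within {0..\<tau>})" for y :: "real \<Rightarrow> 'a" and v
  proof -
    have "(y has_vector_derivative v) (at t within {t..\<tau>})"
      using that by (rule has_vector_derivative_within_subset) (use t in auto)
    then obtain \<eta> where "\<eta> > 0" "\<And>s. s \<in> {t..\<tau>} \<Longrightarrow> norm (s - t) < \<eta> \<Longrightarrow>
        norm (y s - y t - (s - t) *\<^sub>R v) \<le> d * norm (s - t)"
      using d(1) unfolding has_vector_derivative_def has_derivative_within_alt by blast
    then show ?thesis unfolding eventually_at dist_norm by blast
  qed
  have evx: "\<forall>\<^sub>F s in at t within {t..\<tau>}. norm (x s - x t - (s - t) *\<^sub>R b) \<le> d * norm (s - t)"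
    unfolding b_def using t by (intro ev_vec dx) auto
  have evP: "\<forall>\<^sub>F s in at t within {t..\<tau>}. norm (P s - P t - (s - t) *\<^sub>R (- a)) \<le> d * norm (s - t)"
    unfolding a_def using t by (intro ev_vec dP) auto
  have "\<forall>\<^sub>F s in at t within {t..\<tau>}. s \<in> {t..\<tau>}"
    by (simp add: eventually_at_filter)
  with ev\<phi> evx evP show ?thesis
  proof eventually_elim
    case (elim s)
    define k where "k = s - t"
    have k: "0 \<le> k" and s: "t \<le> s" "s \<le> \<tau>" using elim by (auto simp: k_def)
    define r1 where "r1 = x s - x t - k *\<^sub>R b"
    define r2 where "r2 = P s - P t - k *\<^sub>R (- a)"
    define w where "w = W s - W t"
    have r: "norm r1 \<le> d * k" "norm r2 \<le> d * k"
      using elim k by (simp_all add: r1_def r2_def k_def)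
    have w: "norm (U s - U t) \<le> w" unfolding w_def using t s by (intro UW) auto
    have \<Delta>: "z s - z t = (r1 + k *\<^sub>R b, r2 - k *\<^sub>R a + (U s - U t))"
      by (simp add: z_def r1_def r2_def algebra_simps)
    \<comment> \<open>The only contribution of the control. The factor S cancels against the 2 S in
      the derivative of the root, which leaves c / 2.\<close>
    have Ub: "(U s - U t) \<bullet> b \<le> c * w * S"
    proof -
      have "(U s - U t) \<bullet> b \<le> norm (U s - U t) * norm b" by (rule norm_cauchy_schwarz)
      also have "\<dots> \<le> w * (c * S)"
      proof (rule mult_mono)
        have "norm b \<le> c * sqrt h" unfolding b_def h_def by (rule Gp_bound)
        also have "\<dots> \<le> c * S" using S c_pos by simp
        finally show "norm b \<le> c * S" .
      qed (use w in \<open>auto intro: order_trans[OF norm_ge_zero]\<close>)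
      finally show ?thesis by (simp add: mult_ac)
    qed
    have "r1 \<bullet> a + r2 \<bullet> b \<le> d * k * norm a + d * k * norm b"
      using r by (intro add_mono order_trans[OF norm_cauchy_schwarz] mult_right_mono) auto
    also have "\<dots> = d * k * N" by (simp add: N_def algebra_simps)
    \<comment> \<open>The flow terms k b paired with a and -k a paired with b cancel: conservation
      of energy to first order.\<close>
    finally have "fst (z s - z t) \<bullet> a + snd (z s - z t) \<bullet> b \<le> d * k * N + c * w * S"
      using Ub by (simp add: \<Delta> inner_add_left inner_diff_left inner_commute[of b a])
    then have "D (z s - z t) \<le> (d * k * N + c * w * S) / (2 * S)"
      unfolding D_def using S by (intro divide_right_mono) auto
    also have "\<dots> = d * k * (N / (2 * S)) + c / 2 * w" using S by (simp add: field_simps)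
    finally have 1: "D (z s - z t) \<le> d * k * (N / (2 * S)) + c / 2 * w" .
    have "norm (z s - z t) \<le> norm (r1 + k *\<^sub>R b) + norm (r2 - k *\<^sub>R a + (U s - U t))"
      unfolding \<Delta> by (rule norm_Pair_le)
    also have "\<dots> \<le> (norm r1 + norm (k *\<^sub>R b)) + (norm r2 + norm (k *\<^sub>R a) + norm (U s - U t))"
      by (intro add_mono norm_triangle_ineq order_trans[OF norm_triangle_ineq]
          norm_triangle_ineq4 order_refl)
    also have "\<dots> \<le> (d * k + k * norm b) + (d * k + k * norm a + w)"
      using r w k by (intro add_mono) auto
    also have "\<dots> \<le> k * (N + 2) + w"
      using mult_right_mono[OF d(2) k] by (simp add: N_def algebra_simps)
    \<comment> \<open>The increment of z contains w, which is not controlled by k. Its share of the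
      error is charged to W instead, whence the slope \<open>c / 2 + e\<close> in front of
      W.\<close>
    finally have "d * norm (z s - z t) \<le> d * (k * (N + 2) + w)"
      using d by (intro mult_left_mono) auto
    also have "\<dots> \<le> d * k * (N + 2) + e * w"
      using mult_right_mono[OF d(3), of w] w order_trans[OF norm_ge_zero w] by (simp add: algebra_simps)
    finally have 2: "d * norm (z s - z t) \<le> d * k * (N + 2) + e * w" .
    have "\<phi> (z s) - \<phi> (z t) \<le> D (z s - z t) + d * norm (z s - z t)"
      using elim(1) by (simp add: abs_le_iff)
    also have "\<dots> \<le> (d * (N / (2 * S) + N + 2)) * k + (c / 2 + e) * w"
      using 1 2 by (simp add: algebra_simps)
    finally have "\<phi> (z s) - \<phi> (z t) \<le> e * (s - t) + (c / 2 + e) * (W s - W t)"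
      unfolding d(4) by (simp add: k_def w_def)
    then show ?case
      unfolding \<phi>_def z_def fst_conv snd_conv right_diff_distrib by linarith
  qed
qed

lemma energy_bound:
  fixes x P U :: "real \<Rightarrow> 'a" and W :: "real \<Rightarrow> real"
  assumes \<tau>: "0 \<le> \<tau>"
    and cont: "continuous_on {0..\<tau>} x" "continuous_on {0..\<tau>} P" "continuous_on {0..\<tau>} U"
      "continuous_on {0..\<tau>} W"
    and W0: "U 0 = 0" "W 0 = 0"
    and UW: "\<And>s t. 0 \<le> s \<Longrightarrow> s \<le> t \<Longrightarrow> t \<le> \<tau> \<Longrightarrow> norm (U t - U s) \<le> W t - W s"
    and dx: "\<And>t. t \<in> {0..\<tau>} \<Longrightarrow>
        (x has_vector_derivative Gp (x t) (P t + U t)) (at t within {0..\<tau>})"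
    and dP: "\<And>t. t \<in> {0..\<tau>} \<Longrightarrow>
        (P has_vector_derivative - Gx (x t) (P t + U t)) (at t within {0..\<tau>})"
  shows "sqrt (H (x \<tau>) (P \<tau> + U \<tau>)) \<le> sqrt (H (x 0) (P 0)) + c / 2 * W \<tau>"
proof -
  have W: "0 \<le> W \<tau>" using UW[of 0 \<tau>] \<tau> W0 norm_ge_zero[of "U \<tau> - U 0"] by linarith
  have *: "sqrt (H (x \<tau>) (P \<tau> + U \<tau>)) \<le> sqrt (H (x 0) (P 0)) + c / 2 * W \<tau> + e * (1 + W \<tau> + \<tau>)"
    if e: "0 < e" "e < 1" for e
  proof -
    \<comment> \<open>Regularising with the square of e means that removing it from the root costs
      at most e. The total loss is then \<open>e * (1 + W \<tau> + \<tau>)\<close>, which tends to 0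
      with e.\<close>
    define g where "g s = sqrt (H (x s) (P s + U s) + e\<^sup>2) - (c / 2 + e) * W s - e * s" for s
    have "g \<tau> \<le> g 0"
    proof (rule locally_nonincreasing_imp_le[OF _ \<tau>])
      show "continuous_on {0..\<tau>} g"
        unfolding g_def by (intro continuous_intros continuous_on_H cont)
      show "\<forall>\<^sub>F s in at t within {t..\<tau>}. g s \<le> g t" if "0 \<le> t" "t < \<tau>" for t
        unfolding g_def using that e by (intro energy_local cont UW dx dP) auto
    qed
    moreover have "sqrt (H (x \<tau>) (P \<tau> + U \<tau>)) \<le> sqrt (H (x \<tau>) (P \<tau> + U \<tau>) + e\<^sup>2)" by simp
    moreover have "sqrt (H (x 0) (P 0) + e\<^sup>2) \<le> sqrt (H (x 0) (P 0)) + e"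
      using sqrt_add_le_add_sqrt[OF H_nonneg zero_le_power2, of "x 0" "P 0" e] e by simp
    ultimately show ?thesis unfolding g_def W0 ring_distribs add_0_right mult_zero_right by linarith
  qed
  show ?thesis
  proof (rule field_le_epsilon)
    fix \<eta> :: real assume \<eta>: "0 < \<eta>"
    define e where "e = min (1/2) (\<eta> / (1 + W \<tau> + \<tau>))"
    have pos: "0 < 1 + W \<tau> + \<tau>" using W \<tau> by linarith
    then have e: "0 < e" "e < 1" using \<eta> by (auto simp: e_def)
    have "e * (1 + W \<tau> + \<tau>) \<le> \<eta> / (1 + W \<tau> + \<tau>) * (1 + W \<tau> + \<tau>)"
      using pos by (intro mult_right_mono) (auto simp: e_def)
    then show "sqrt (H (x \<tau>) (P \<tau> + U \<tau>)) \<le> sqrt (H (x 0) (P 0)) + c / 2 * W \<tau> + \<eta>"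
      using *[OF e] pos by simp
  qed
qed

text \<open>\<open>P\<close> is the momentum minus the accumulated control; its integrand is
  continuous, so it is differentiable where \<open>P + U\<close> need not be. The bounds use
  \<open>W T\<close> instead of \<open>W \<tau>\<close>, so that one B serves all initial
  segments.\<close>

lemma trajectory_bounds:
  fixes x P u :: "real \<Rightarrow> 'a"
  defines "U \<equiv> \<lambda>t. integral {0..t} u" and "W \<equiv> \<lambda>t. integral {0..t} (\<lambda>s. norm (u s))"
  assumes u: "u absolutely_integrable_on {0..T}" and \<tau>: "0 \<le> \<tau>" "\<tau> \<le> T"
    and cont: "continuous_on {0..\<tau>} x" "continuous_on {0..\<tau>} P"
    and x: "\<forall>t\<in>{0..\<tau>}. x t = x0 + integral {0..t} (\<lambda>s. Gp (x s) (P s + U s))"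
    and P: "\<forall>t\<in>{0..\<tau>}. P t = p0 - integral {0..t} (\<lambda>s. Gx (x s) (P s + U s))"
    and B: "sqrt (H x0 p0) + c / 2 * W T \<le> B"
  shows "sqrt (H (x \<tau>) (P \<tau> + U \<tau>)) \<le> B"
    and "norm (x \<tau>) \<le> norm x0 + c * B * \<tau>"
    and "norm (P \<tau> + U \<tau>) \<le> (norm p0 + W T) * exp (c * B * \<tau>)"
    and "norm (U \<tau>) \<le> W T"
proof -
  have iu: "u integrable_on {0..T}" and iw: "(\<lambda>s. norm (u s)) integrable_on {0..T}"
    using u by (auto simp: absolutely_integrable_on_def)
  have Wle: "W s \<le> W t" if "0 \<le> s" "s \<le> t" "t \<le> T" for s t
    unfolding W_def using that
    by (intro integral_subset_le integrable_on_subinterval[OF iw]) auto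
  have UW: "norm (U t - U s) \<le> W t - W s" if st: "0 \<le> s" "s \<le> t" "t \<le> T" for s t
  proof -
    have "integral {0..s} u + integral {s..t} u = integral {0..t} u"
      "W s + integral {s..t} (\<lambda>s. norm (u s)) = W t"
      unfolding W_def using st
      by (auto intro!: Henstock_Kurzweil_Integration.integral_combine
          intro: integrable_on_subinterval[OF iu] integrable_on_subinterval[OF iw])
    moreover have "norm (integral {s..t} u) \<le> integral {s..t} (\<lambda>s. norm (u s))"
      using st by (intro integral_norm_bound_integral)
        (auto intro: integrable_on_subinterval[OF iu] integrable_on_subinterval[OF iw])
    ultimately show ?thesis unfolding U_def by (metis add_diff_cancel_left')
  qed
  have W0: "U 0 = 0" "W 0 = 0" by (simp_all add: U_def W_def)
  then show U_le: "norm (U \<tau>) \<le> W T" using UW[of 0 \<tau>] Wle[of \<tau> T] \<tau> by simp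
  have U_cont: "continuous_on {0..\<tau>} U" and W_cont: "continuous_on {0..\<tau>} W"
    unfolding U_def W_def using \<tau>
    by (auto intro!: indefinite_integral_continuous_1 integrable_on_subinterval[OF iu]
        integrable_on_subinterval[OF iw])
  define p where "p s = P s + U s" for s
  have p_cont: "continuous_on {0..\<tau>} p" unfolding p_def by (intro continuous_intros cont U_cont)
  note G_cont = continuous_on_G[OF cont(1) p_cont]
  have dx: "(x has_vector_derivative Gp (x t) (P t + U t)) (at t within {0..\<tau>})"
    if t: "t \<in> {0..\<tau>}" for t
  proof -
    have "((\<lambda>t. x0 + integral {0..t} (\<lambda>s. Gp (x s) (p s))) has_vector_derivative
        (0 + Gp (x t) (p t))) (at t within {0..\<tau>})"
      by (intro derivative_intros integral_has_vector_derivative G_cont t)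
    then show ?thesis
      using x t by (auto simp: p_def intro: has_vector_derivative_transform)
  qed
  have dP: "(P has_vector_derivative - Gx (x t) (P t + U t)) (at t within {0..\<tau>})"
    if t: "t \<in> {0..\<tau>}" for t
  proof -
    have "((\<lambda>t. p0 - integral {0..t} (\<lambda>s. Gx (x s) (p s))) has_vector_derivative
        (0 - Gx (x t) (p t))) (at t within {0..\<tau>})"
      by (intro derivative_intros integral_has_vector_derivative G_cont t)
    then show ?thesis
      using P t by (auto simp: p_def intro: has_vector_derivative_transform)
  qed
  \<comment> \<open>Applied on each shorter segment [0, t], because the bounds on x and p integrate
    the energy estimate over time.\<close>
  have sqrtH: "sqrt (H (x t) (p t)) \<le> B" if t: "t \<in> {0..\<tau>}" for t
  proof -
    have sub: "{0..t} \<subseteq> {0..\<tau>}" using t by auto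
    have "sqrt (H (x t) (P t + U t)) \<le> sqrt (H (x 0) (P 0)) + c / 2 * W t"
    proof (rule energy_bound)
      show "(x has_vector_derivative Gp (x s) (P s + U s)) (at s within {0..t})"
        and "(P has_vector_derivative - Gx (x s) (P s + U s)) (at s within {0..t})"
        if "s \<in> {0..t}" for s
        using that t by (auto intro!: has_vector_derivative_within_subset[OF dx sub]
            has_vector_derivative_within_subset[OF dP sub])
    qed (use t \<tau> W0 UW in \<open>auto intro: continuous_on_subset[OF _ sub] cont U_cont W_cont\<close>)
    also have "x 0 = x0" using bspec[OF x, of 0] \<tau> by simp
    also have "P 0 = p0" using bspec[OF P, of 0] \<tau> by simp
    also have "sqrt (H x0 p0) + c / 2 * W t \<le> B"
    proof -
      have "c / 2 * W t \<le> c / 2 * W T" using Wle[of t T] t \<tau> c_pos by (intro mult_left_mono) auto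
      then show ?thesis using B by linarith
    qed
    finally show ?thesis by (simp add: p_def)
  qed
  then show "sqrt (H (x \<tau>) (P \<tau> + U \<tau>)) \<le> B" using \<tau> by (simp add: p_def)
  have B0: "0 \<le> B" using order_trans[OF real_sqrt_ge_zero[OF H_nonneg] sqrtH[of 0]] \<tau> by simp
  have "norm (integral {0..\<tau>} (\<lambda>s. Gp (x s) (p s)) - integral {0..0} (\<lambda>s. Gp (x s) (p s)))
      \<le> c * B * \<bar>\<tau> - 0\<bar>"
  proof (rule integral_diff_bound[of _ \<tau>])
    show "norm (Gp (x s) (p s)) \<le> c * B" if "s \<in> {0..\<tau>}" for s
      using sqrtH[OF that] c_pos by (intro order_trans[OF Gp_bound] mult_left_mono) auto
  qed (use \<tau> in \<open>auto intro: integrable_continuous_real G_cont\<close>)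
  then have "norm (x \<tau> - x0) \<le> c * B * \<tau>" using bspec[OF x, of \<tau>] \<tau> by (simp add: p_def)
  then show "norm (x \<tau>) \<le> norm x0 + c * B * \<tau>" using norm_triangle_sub[of "x \<tau>" x0] by linarith
  \<comment> \<open>Bounding \<open>U t\<close> by \<open>W T\<close> makes the additive term of the
    Gronwall inequality constant in t.\<close>
  have "norm (p \<tau>) \<le> (norm p0 + W T) * exp (c * B * \<tau>)"
  proof (rule gronwall)
    show "continuous_on {0..\<tau>} (\<lambda>t. norm (p t))" by (intro continuous_intros p_cont)
    fix t assume t: "t \<in> {0..\<tau>}"
    then have sub: "{0..t} \<subseteq> {0..\<tau>}" by auto
    have "norm (integral {0..t} (\<lambda>s. Gx (x s) (p s))) \<le> integral {0..t} (\<lambda>s. c * B * norm (p s))"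
    proof (rule integral_norm_bound_integral)
      show "norm (Gx (x s) (p s)) \<le> c * B * norm (p s)" if "s \<in> {0..t}" for s
        using sqrtH[of s] that t c_pos
        by (intro order_trans[OF Gx_bound] mult_right_mono mult_left_mono) auto
    qed (auto intro!: integrable_continuous_real continuous_intros
          continuous_on_subset[OF G_cont(1) sub] continuous_on_subset[OF p_cont sub])
    moreover have "norm (p t) \<le> norm p0 + norm (integral {0..t} (\<lambda>s. Gx (x s) (p s))) + norm (U t)"
      using bspec[OF P t] norm_triangle_ineq[of "P t" "U t"]
        norm_triangle_ineq4[of p0 "integral {0..t} (\<lambda>s. Gx (x s) (p s))"]
      by (simp add: p_def)
    moreover have "norm (U t) \<le> W T" using UW[of 0 t] Wle[of t T] W0 t \<tau> by simp
    ultimately show "norm (p t) \<le> norm p0 + W T + c * B * integral {0..t} (\<lambda>t. norm (p t))"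
      by simp
  qed (use \<tau> B0 c_pos in auto)
  then show "norm (P \<tau> + U \<tau>) \<le> (norm p0 + W T) * exp (c * B * \<tau>)" by (simp add: p_def)
qed

lemma controlled_trajectory_exists:
  fixes u :: "real \<Rightarrow> 'a" and T :: real
  defines "W \<equiv> integral {0..T} (\<lambda>s. norm (u s))"
  assumes T: "0 \<le> T" and u: "u absolutely_integrable_on {0..T}"
    and B: "sqrt (H x0 p0) + c / 2 * W \<le> B"
  obtains x p where "continuous_on {0..T} x" "continuous_on {0..T} p"
    and "\<And>t. t \<in> {0..T} \<Longrightarrow> x t = x0 + integral {0..t} (\<lambda>s. Gp (x s) (p s))"
    and "\<And>t. t \<in> {0..T} \<Longrightarrow> p t = p0 + integral {0..t} (\<lambda>s. - Gx (x s) (p s) + u s)"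
    and "\<And>t. t \<in> {0..T} \<Longrightarrow> sqrt (H (x t) (p t)) \<le> B"
    and "\<And>t. t \<in> {0..T} \<Longrightarrow> norm (x t) \<le> norm x0 + c * B * t"
    and "\<And>t. t \<in> {0..T} \<Longrightarrow> norm (p t) \<le> (norm p0 + W) * exp (c * B * t)"
proof -
  define U where "U t = integral {0..t} u" for t
  define f where "f s q = (Gp (fst q) (snd q + U s), - Gx (fst q) (snd q + U s))" for s and q :: "'a \<times> 'a"
  have iu: "u integrable_on {0..T}" using u by (auto simp: absolutely_integrable_on_def)
  have U_cont: "continuous_on {0..T} U"
    unfolding U_def by (intro indefinite_integral_continuous_1 iu)
  have f_cont: "continuous_on ({0..T} \<times> UNIV) (\<lambda>z. f (fst z) (snd z))"
    unfolding f_def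
    by (intro continuous_intros continuous_on_G continuous_on_compose2[OF U_cont]) auto
  have B0: "0 \<le> B"
  proof -
    have "0 \<le> W" unfolding W_def by (intro Henstock_Kurzweil_Integration.integral_nonneg)
        (use u in \<open>auto simp: absolutely_integrable_on_def\<close>)
    then show ?thesis using B c_pos H_nonneg[of x0 p0]
      by (meson add_nonneg_nonneg half_gt_zero less_imp_le mult_nonneg_nonneg order_trans real_sqrt_ge_zero)
  qed
  have split: "continuous_on {0..\<tau>} (\<lambda>t. fst (q t))" "continuous_on {0..\<tau>} (\<lambda>t. snd (q t))"
    "\<forall>t\<in>{0..\<tau>}. fst (q t) = x0 + integral {0..t} (\<lambda>s. Gp (fst (q s)) (snd (q s) + U s))"
    "\<forall>t\<in>{0..\<tau>}. snd (q t) = p0 - integral {0..t} (\<lambda>s. Gx (fst (q s)) (snd (q s) + U s))"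
    if \<tau>: "\<tau> \<in> {0..T}" and q: "continuous_on {0..\<tau>} q"
      "\<forall>t\<in>{0..\<tau>}. q t = (x0, p0) + integral {0..t} (\<lambda>s. f s (q s))" for \<tau> q
  proof -
    show c: "continuous_on {0..\<tau>} (\<lambda>t. fst (q t))" "continuous_on {0..\<tau>} (\<lambda>t. snd (q t))"
      by (intro continuous_intros q)+
    have *: "fst (q t) = x0 + integral {0..t} (\<lambda>s. Gp (fst (q s)) (snd (q s) + U s)) \<and>
      snd (q t) = p0 - integral {0..t} (\<lambda>s. Gx (fst (q s)) (snd (q s) + U s))"
      if t: "t \<in> {0..\<tau>}" for t
    proof -
      have sub: "{0..t} \<subseteq> {0..\<tau>}" "{0..t} \<subseteq> {0..T}" using t \<tau> by auto
      have "continuous_on {0..t} (\<lambda>s. f s (q s))"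
        unfolding f_def
        by (intro continuous_intros continuous_on_G continuous_on_subset[OF c(1) sub(1)]
            continuous_on_subset[OF c(2) sub(1)] continuous_on_subset[OF U_cont sub(2)])
      then have i: "(\<lambda>s. f s (q s)) integrable_on {0..t}" by (rule integrable_continuous_real)
      have "fst (integral {0..t} (\<lambda>s. f s (q s))) = integral {0..t} (\<lambda>s. fst (f s (q s)))"
        "snd (integral {0..t} (\<lambda>s. f s (q s))) = integral {0..t} (\<lambda>s. snd (f s (q s)))"
        using integral_linear[OF i bounded_linear_fst] integral_linear[OF i bounded_linear_snd]
        by (simp_all add: o_def)
      then show ?thesis
        using bspec[OF q(2) t] by (simp add: f_def)
    qed
    then show "\<forall>t\<in>{0..\<tau>}. fst (q t) = x0 + integral {0..t} (\<lambda>s. Gp (fst (q s)) (snd (q s) + U s))"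
      "\<forall>t\<in>{0..\<tau>}. snd (q t) = p0 - integral {0..t} (\<lambda>s. Gx (fst (q s)) (snd (q s) + U s))"
      by simp_all
  qed
  note bounds = trajectory_bounds[OF u _ _ _ _ _ _ B[unfolded W_def], folded W_def U_def]
  define M where "M = (norm x0 + c * B * T) + ((norm p0 + W) * exp (c * B * T) + W)"
  have W0: "0 \<le> norm p0 + W"
    unfolding W_def
    by (intro add_nonneg_nonneg Henstock_Kurzweil_Integration.integral_nonneg)
      (use u in \<open>auto simp: absolutely_integrable_on_def\<close>)
  obtain q where q: "continuous_on {0..T} q"
    "\<forall>t\<in>{0..T}. q t = (x0, p0) + integral {0..t} (\<lambda>s. f s (q s))"
  proof (rule peano_apriori[OF T f_cont])
    fix \<tau> q
    assume \<tau>: "\<tau> \<in> {0..T}" and q: "continuous_on {0..\<tau>} q"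
      and "\<And>t. t \<in> {0..\<tau>} \<Longrightarrow> q t = (x0, p0) + integral {0..t} (\<lambda>s. f s (q s))"
    then have "\<forall>t\<in>{0..\<tau>}. q t = (x0, p0) + integral {0..t} (\<lambda>s. f s (q s))" by simp
    note s = split[OF \<tau> q this]
    note b = bounds[OF _ _ s]
    \<comment> \<open>The unknown q stores P, not P + U, so returning from the momentum bound to q
      costs a further \<open>W\<close>.\<close>
    have "norm (q \<tau>) \<le> norm (fst (q \<tau>)) + norm (snd (q \<tau>))"
      using norm_Pair_le[of "fst (q \<tau>)" "snd (q \<tau>)"] by simp
    also have "norm (snd (q \<tau>)) \<le> norm (snd (q \<tau>) + U \<tau>) + norm (U \<tau>)"
      using norm_triangle_ineq4[of "snd (q \<tau>) + U \<tau>" "U \<tau>"] by simp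
    also have "norm (fst (q \<tau>)) + (norm (snd (q \<tau>) + U \<tau>) + norm (U \<tau>))
        \<le> (norm x0 + c * B * \<tau>) + ((norm p0 + W) * exp (c * B * \<tau>) + W)"
      using \<tau> by (intro add_mono b) auto
    also have "\<dots> \<le> M"
      unfolding M_def using \<tau> W0 c_pos B0
      by (intro add_mono mult_left_mono order_refl) (auto intro!: mult_left_mono)
    finally show "norm (q \<tau>) \<le> M" by simp
  qed (use that in blast)
  have TT: "T \<in> {0..T}" using T by simp
  note s = split[OF TT q]
  define x where "x t = fst (q t)" for t
  define p where "p t = snd (q t) + U t" for t
  have p_cont: "continuous_on {0..T} p" unfolding p_def by (intro continuous_intros s U_cont)
  note s = s[folded x_def, folded p_def]
  have x_cont: "continuous_on {0..T} x" unfolding x_def by (intro continuous_intros q)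
  have sq: "\<tau> \<in> {0..T} \<Longrightarrow> continuous_on {0..\<tau>} q" for \<tau>
    by (rule continuous_on_subset[OF q(1)]) auto
  show thesis
  proof (rule that[of x p])
    fix t assume t: "t \<in> {0..T}"
    then have sub: "{0..t} \<subseteq> {0..T}" by auto
    show "x t = x0 + integral {0..t} (\<lambda>s. Gp (x s) (p s))"
      using bspec[OF s(3) t] .
    have "integral {0..t} (\<lambda>s. - Gx (x s) (p s) + u s)
        = - integral {0..t} (\<lambda>s. Gx (x s) (p s)) + U t"
    proof -
      have "(\<lambda>s. Gx (x s) (p s)) integrable_on {0..t}"
        by (intro integrable_continuous_real continuous_on_G continuous_on_subset[OF _ sub]
            x_cont p_cont)
      moreover have "u integrable_on {0..t}"
        using t by (intro integrable_on_subinterval[OF iu]) auto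
      ultimately show ?thesis unfolding U_def
        by (subst Henstock_Kurzweil_Integration.integral_add)
          (auto intro: Henstock_Kurzweil_Integration.integrable_neg)
    qed
    then show "p t = p0 + integral {0..t} (\<lambda>s. - Gx (x s) (p s) + u s)"
      using bspec[OF s(4) t] by (simp add: p_def)
    have qt: "\<forall>r\<in>{0..t}. q r = (x0, p0) + integral {0..r} (\<lambda>s. f s (q s))"
      using q(2) t by auto
    have "0 \<le> t" "t \<le> T" using t by auto
    note b = bounds[OF this split[OF t sq[OF t] qt]]
    show "sqrt (H (x t) (p t)) \<le> B" "norm (x t) \<le> norm x0 + c * B * t"
      "norm (p t) \<le> (norm p0 + W) * exp (c * B * t)"
      unfolding x_def p_def by (rule b; assumption)+
  qed (rule x_cont p_cont)+
qed

end

subsection \<open>The Hamiltonian of an embedded kernel space\<close>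

text \<open>The real-valued suprema in \<open>norm_1_inf\<close> dominate their members only if the
  ranges are bounded above; this provides it for the values of a field.\<close>

lemma bounded_of_vanishing_at_infinity:
  fixes v :: "'a::euclidean_space \<Rightarrow> 'b::real_normed_vector"
  assumes cont: "continuous_on UNIV v" and lim: "(v \<longlongrightarrow> 0) at_infinity"
  shows "bdd_above (range (\<lambda>z. norm (v z)))"
proof -
  have "\<forall>\<^sub>F z in at_infinity. norm (v z) < 1"
    using tendstoD[OF lim, of 1] by (simp add: dist_norm)
  then obtain b where b: "\<And>z. b \<le> norm z \<Longrightarrow> norm (v z) < 1"
    unfolding eventually_at_infinity by blast
  have "compact (v ` cball 0 b)"
    by (intro compact_continuous_image continuous_on_subset[OF cont]) auto
  then obtain M where M: "\<And>z. z \<in> cball 0 b \<Longrightarrow> norm (v z) \<le> M"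
    by (force dest!: compact_imp_bounded simp: bounded_iff)
  show ?thesis
  proof (rule bdd_aboveI2)
    show "norm (v z) \<le> max M 1" for z
      using b[of z] M[of z] by (cases "norm z \<le> b") auto
  qed
qed

lemma embedding_bounds:
  fixes ev :: "'v::{real_inner,complete_space} \<Rightarrow> 'a::euclidean_space \<Rightarrow> 'a"
  assumes emb: "continuously_embedded_C1 ev"
  obtains C and D :: "'v \<Rightarrow> 'a \<Rightarrow> 'a \<Rightarrow>\<^sub>L 'a" where "0 < C"
    and "\<And>v z. (ev v has_derivative blinfun_apply (D v z)) (at z)"
    and "\<And>v. continuous_on UNIV (D v)"
    and "\<And>v z. norm (ev v z) \<le> C * norm v"
    and "\<And>v z. norm (D v z) \<le> C * norm v"
proof -
  have van: "ev v \<in> C1_vanishing" for v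
    using emb by (auto simp: continuously_embedded_C1_def)
  obtain C where C: "\<And>v. norm_1_inf (ev v) \<le> C * norm v"
    using emb by (auto simp: continuously_embedded_C1_def)
  have "\<forall>v. \<exists>f'. (\<forall>z. (ev v has_derivative blinfun_apply (f' z)) (at z)) \<and> continuous_on UNIV f'"
    using van by (auto simp: C1_vanishing_def C1_map_def)
  then obtain D where D: "\<And>v z. (ev v has_derivative blinfun_apply (D v z)) (at z)"
    "\<And>v. continuous_on UNIV (D v)" by metis
  have fd: "frechet_derivative (ev v) (at z) = blinfun_apply (D v z)" for v z
    using frechet_derivative_at[OF D(1)] by simp
  have bdd: "bdd_above (range (\<lambda>z. norm (ev v z)))" "bdd_above (range (\<lambda>z. norm (D v z)))" for v
  proof -
    have "continuous_on UNIV (ev v)"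
      using has_derivative_continuous[OF D(1)] by (intro continuous_at_imp_continuous_on) blast
    then show "bdd_above (range (\<lambda>z. norm (ev v z)))"
      using van[of v] by (intro bounded_of_vanishing_at_infinity) (auto simp: C1_vanishing_def)
    show "bdd_above (range (\<lambda>z. norm (D v z)))"
      using van[of v] by (auto simp: C1_vanishing_def fd norm_blinfun.rep_eq)
  qed
  \<comment> \<open>The embedding constant is not assumed positive, hence
    \<open>\<bar>C\<bar> + 1\<close>. Both suprema are kept on the left, so one constant bounds the
    field and its derivative.\<close>
  have le: "norm (ev v z) + norm (D v z') \<le> (\<bar>C\<bar> + 1) * norm v" for v z z'
  proof -
    have "norm (ev v z) + norm (D v z') \<le> norm_1_inf (ev v)"
      unfolding norm_1_inf_def fd norm_blinfun.rep_eq[symmetric]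
      by (intro add_mono cSUP_upper bdd) auto
    also have "\<dots> \<le> C * norm v" by (rule C)
    also have "\<dots> \<le> (\<bar>C\<bar> + 1) * norm v" by (intro mult_right_mono) auto
    finally show ?thesis .
  qed
  show thesis
  proof (rule that[OF _ D])
    show "norm (ev v z) \<le> (\<bar>C\<bar> + 1) * norm v" for v z
      using le[of v z z] norm_ge_zero[of "D v z"] by linarith
    show "norm (D v z) \<le> (\<bar>C\<bar> + 1) * norm v" for v z
      using le[of v z z] norm_ge_zero[of "ev v z"] by linarith
  qed auto
qed

text \<open>Separate continuity becomes joint because the modulus in w is uniform in y: first change
  w at the moved point y', then move y' to y with w fixed.\<close>

lemma continuous_on_pair_if_uniform:
  fixes F :: "'v::real_normed_vector \<Rightarrow> 'a::t2_space \<Rightarrow> 'b::real_normed_vector"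
  assumes cont: "\<And>w. continuous_on UNIV (F w)"
    and Lip: "\<And>w w' y. norm (F w' y - F w y) \<le> C * norm (w' - w)"
  shows "continuous_on UNIV (\<lambda>z. F (fst z) (snd z))"
proof (rule continuous_at_imp_continuous_on, rule ballI)
  fix z :: "'v \<times> 'a"
  have s: "((\<lambda>z'. snd z') \<longlongrightarrow> snd z) (at z)" and f: "((\<lambda>z'. fst z') \<longlongrightarrow> fst z) (at z)"
    by (auto intro: tendsto_fst tendsto_snd)
  have "((\<lambda>z'. C * norm (fst z' - fst z)) \<longlongrightarrow> C * norm (fst z - fst z)) (at z)"
    by (intro tendsto_intros f)
  then have "((\<lambda>z'. C * norm (fst z' - fst z)) \<longlongrightarrow> 0) (at z)" by simp
  then have "((\<lambda>z'. F (fst z') (snd z') - F (fst z) (snd z')) \<longlongrightarrow> 0) (at z)"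
    by (rule Lim_null_comparison[rotated]) (simp add: Lip)
  moreover have "((\<lambda>z'. F (fst z) (snd z')) \<longlongrightarrow> F (fst z) (snd z)) (at z)"
    using cont s by (intro continuous_on_tendsto_compose[OF cont s]) auto
  ultimately have "((\<lambda>z'. F (fst z') (snd z') - F (fst z) (snd z') + F (fst z) (snd z'))
      \<longlongrightarrow> 0 + F (fst z) (snd z)) (at z)" by (rule tendsto_add)
  then show "isCont (\<lambda>z. F (fst z) (snd z)) z" by (simp add: isCont_def)
qed

section \<open>Gradients, adjoints and norms in Euclidean space\<close>

lemma gradient_eqI:
  assumes "GDERIV f x :> D"
  shows "gradient f x = D"
  unfolding gradient_def
proof (rule the_equality)
  show "GDERIV f x :> D" by (rule assms)
  fix E assume "GDERIV f x :> E"
  then have "(\<lambda>h. h \<bullet> E) = (\<lambda>h. h \<bullet> D)"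
    using assms has_derivative_unique unfolding gderiv_def by blast
  then have "(E - D) \<bullet> E = (E - D) \<bullet> D" by (rule fun_cong)
  then have "(E - D) \<bullet> (E - D) = 0" by (simp add: inner_diff_right)
  then show "E = D" by simp
qed

text \<open>Expresses the adjoint through finitely many values of f, so that its continuous
  dependence on an operator-valued parameter can be checked term by term.\<close>

lemma adjoint_basis_sum:
  fixes f :: "'a::euclidean_space \<Rightarrow> 'b::euclidean_space"
  assumes "linear f"
  shows "adjoint f y = (\<Sum>b\<in>Basis. (f b \<bullet> y) *\<^sub>R b)"
  using euclidean_representation[of "adjoint f y"] adjoint_works[OF assms, of _ y]
  by (simp add: inner_commute)

lemma norm_adjoint_blinfun_le:
  fixes f :: "'a::euclidean_space \<Rightarrow>\<^sub>L 'b::euclidean_space"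
  shows "norm (adjoint (blinfun_apply f) y) \<le> norm f * norm y"
proof -
  let ?a = "adjoint (blinfun_apply f) y"
  have "norm ?a * norm ?a = blinfun_apply f ?a \<bullet> y"
    using adjoint_works[OF bounded_linear.linear[OF blinfun.bounded_linear_right], of ?a f y]
    by (simp flip: power2_eq_square add: power2_norm_eq_inner)
  also have "\<dots> \<le> norm (blinfun_apply f ?a) * norm y" by (rule norm_cauchy_schwarz)
  also have "\<dots> \<le> norm f * norm ?a * norm y" by (intro mult_right_mono norm_blinfun) auto
  finally have "norm ?a * norm ?a \<le> (norm f * norm y) * norm ?a" by (simp add: mult_ac)
  then show ?thesis
    by (cases "norm ?a = 0") (auto simp: mult_le_cancel_right)
qed

lemma norm_vec_le_sum: "norm x \<le> (\<Sum>i\<in>UNIV. norm (x $ i))"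
  unfolding norm_vec_def by (intro L2_set_le_sum) auto

text \<open>Fixes choices of objects that the hypotheses only assert to exist: \<open>D v\<close> is
  the continuous derivative of the field v, and \<open>k z \<alpha>\<close> the element whose field
  is \<open>K\<close> with second argument z, applied to \<alpha>.\<close>

locale embedded_rkhs =
  fixes ev :: "'v::{real_inner,complete_space} \<Rightarrow> real^'d \<Rightarrow> real^'d"
    and K :: "real^'d \<Rightarrow> real^'d \<Rightarrow> real^'d^'d"
    and C :: real
    and D :: "'v \<Rightarrow> real^'d \<Rightarrow> (real^'d) \<Rightarrow>\<^sub>L (real^'d)"
    and k :: "real^'d \<Rightarrow> real^'d \<Rightarrow> 'v"
  assumes C: "0 < C"
    and D: "\<And>v z. (ev v has_derivative blinfun_apply (D v z)) (at z)"
    and continuous_D: "\<And>v. continuous_on UNIV (D v)"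
    and ev_bound: "\<And>v z. norm (ev v z) \<le> C * norm v"
    and D_bound: "\<And>v z. norm (D v z) \<le> C * norm v"
    and linear_ev: "\<And>z. linear (\<lambda>v. ev v z)"
    and ev_k: "\<And>y z \<alpha>. ev (k z \<alpha>) y = K y z *v \<alpha>"
    and inner_k: "\<And>v z \<alpha>. v \<bullet> k z \<alpha> = ev v z \<bullet> \<alpha>"
begin

section \<open>Joint regularity of evaluation, the velocity and the derivative of the
  Hamiltonian\<close>

lemma ev_diff: "ev (v - w) z = ev v z - ev w z"
  using linear_diff[OF linear_ev] .

text \<open>\<open>D\<close> was chosen separately for each field, so linearity in the field has to
  come from uniqueness of the derivative. It turns \<open>D_bound\<close> into a Lipschitz estimate
  in v.\<close>

lemma D_diff: "D (v - w) z = D v z - D w z"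
proof (rule blinfun_eqI)
  fix h
  have "ev (v - w) = (\<lambda>z. ev v z - ev w z)" by (simp add: ev_diff fun_eq_iff)
  then have "(ev (v - w) has_derivative (\<lambda>h. D v z h - D w z h)) (at z)"
    using has_derivative_diff[OF D D] by simp
  then have "blinfun_apply (D (v - w) z) = (\<lambda>h. D v z h - D w z h)"
    by (rule has_derivative_unique[OF D])
  then show "D (v - w) z h = (D v z - D w z) h"
    by (simp add: blinfun.diff_left)
qed

lemma continuous_ev: "continuous_on UNIV (ev v)"
  using has_derivative_continuous[OF D] by (intro continuous_at_imp_continuous_on) blast

lemma ev_Lipschitz: "norm (ev w y - ev w z) \<le> C * norm w * norm (y - z)"
  by (rule differentiable_bound[of UNIV "ev w" "\<lambda>z. blinfun_apply (D w z)"])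
    (auto intro: D D_bound simp flip: norm_blinfun.rep_eq)

lemma continuous_on_ev:
  assumes "continuous_on S w" "continuous_on S y"
  shows "continuous_on S (\<lambda>s. ev (w s) (y s))" "continuous_on S (\<lambda>s. D (w s) (y s))"
proof -
  have 1: "continuous_on UNIV (\<lambda>z. ev (fst z) (snd z))"
    by (rule continuous_on_pair_if_uniform[where C = C])
      (auto intro: continuous_ev simp: ev_bound simp flip: ev_diff)
  have 2: "continuous_on UNIV (\<lambda>z. D (fst z) (snd z))"
    by (rule continuous_on_pair_if_uniform[where C = C])
      (auto intro: continuous_D simp: D_bound simp flip: D_diff)
  have 3: "continuous_on S (\<lambda>s. (w s, y s))" by (intro continuous_intros assms)
  show "continuous_on S (\<lambda>s. ev (w s) (y s))" "continuous_on S (\<lambda>s. D (w s) (y s))"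
    using continuous_on_compose2[OF 1 3] continuous_on_compose2[OF 2 3] by auto
qed

text \<open>The Riesz representer of the functional sending v to the sum of v(x_j) paired with p_j,
  by \<open>inner_velocity\<close>. This dual description moves the dependence on x and p onto a
  fixed test field.\<close>

definition velocity :: "real^'d^'n \<Rightarrow> real^'d^'n \<Rightarrow> 'v" where
  "velocity x p = (\<Sum>j\<in>UNIV. k (x $ j) (p $ j))"

lemma inner_velocity: "v \<bullet> velocity x p = (\<Sum>j\<in>UNIV. ev v (x $ j) \<bullet> p $ j)"
  by (simp add: velocity_def inner_sum_right inner_k)

lemma hamiltonian_eq: "hamiltonian K x p = (norm (velocity x p))\<^sup>2 / 2"
proof -
  have "ev (velocity x p) y = (\<Sum>i\<in>UNIV. K y (x $ i) *v p $ i)" for y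
    unfolding velocity_def by (simp add: linear_sum[OF linear_ev] ev_k)
  then show ?thesis
    by (simp add: hamiltonian_def power2_norm_eq_inner inner_velocity inner_sum_left inner_sum_right inner_commute)
qed

lemma norm_velocity: "norm (velocity x p) = sqrt 2 * sqrt (hamiltonian K x p)"
  by (simp add: hamiltonian_eq flip: real_sqrt_mult)

text \<open>The difference w is tested against itself. The reproducing property turns the pairing
  into values of the field w at the points of x' and x, where w is bounded and Lipschitz with
  constant C |w|; one factor |w| then cancels.\<close>

lemma velocity_diff_bound:
  fixes x x' p p' :: "real^'d^'n"
  shows "norm (velocity x' p' - velocity x p)
    \<le> CARD('n) * C * (norm (x' - x) * norm p' + norm (p' - p))"
proof -
  define w where "w = velocity x' p' - velocity x p"
  have "norm w * norm w = w \<bullet> velocity x' p' - w \<bullet> velocity x p"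
    by (simp add: w_def flip: inner_diff_right power2_eq_square power2_norm_eq_inner)
  also have "\<dots> = (\<Sum>j\<in>UNIV. (ev w (x' $ j) - ev w (x $ j)) \<bullet> p' $ j + ev w (x $ j) \<bullet> (p' - p) $ j)"
    unfolding inner_velocity by (simp add: inner_diff_left inner_diff_right sum_subtractf[symmetric])
  also have "\<dots> \<le> (\<Sum>j\<in>(UNIV::'n set). C * norm w * norm (x' - x) * norm p' + C * norm w * norm (p' - p))"
  proof (intro sum_mono add_mono)
    fix j
    have "(ev w (x' $ j) - ev w (x $ j)) \<bullet> p' $ j \<le> norm (ev w (x' $ j) - ev w (x $ j)) * norm (p' $ j)"
      by (rule norm_cauchy_schwarz)
    also have "\<dots> \<le> C * norm w * norm (x' - x) * norm p'"
    proof (intro mult_mono Finite_Cartesian_Product.norm_nth_le)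
      have "norm (ev w (x' $ j) - ev w (x $ j)) \<le> C * norm w * norm ((x' - x) $ j)"
        using ev_Lipschitz[of w "x' $ j" "x $ j"] by simp
      also have "\<dots> \<le> C * norm w * norm (x' - x)"
        using C by (intro mult_left_mono Finite_Cartesian_Product.norm_nth_le) auto
      finally show "norm (ev w (x' $ j) - ev w (x $ j)) \<le> C * norm w * norm (x' - x)" .
    qed (use C in auto)
    finally show "(ev w (x' $ j) - ev w (x $ j)) \<bullet> p' $ j \<le> C * norm w * norm (x' - x) * norm p'" .
    have "ev w (x $ j) \<bullet> (p' - p) $ j \<le> norm (ev w (x $ j)) * norm ((p' - p) $ j)"
      by (rule norm_cauchy_schwarz)
    also have "\<dots> \<le> C * norm w * norm (p' - p)"
      using C by (intro mult_mono ev_bound Finite_Cartesian_Product.norm_nth_le) auto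
    finally show "ev w (x $ j) \<bullet> (p' - p) $ j \<le> C * norm w * norm (p' - p)" .
  qed
  also have "\<dots> = (CARD('n) * C * (norm (x' - x) * norm p' + norm (p' - p))) * norm w"
    by (simp add: algebra_simps)
  finally have "norm w * norm w \<le> (CARD('n) * C * (norm (x' - x) * norm p' + norm (p' - p))) * norm w" .
  moreover have "0 \<le> CARD('n) * C * (norm (x' - x) * norm p' + norm (p' - p))"
    using C by simp
  ultimately have "norm w \<le> CARD('n) * C * (norm (x' - x) * norm p' + norm (p' - p))"
    by (cases "w = 0") (auto simp: mult_le_cancel_right simp del: mult_le_0_iff)
  then show ?thesis by (simp add: w_def)
qed

lemma continuous_on_velocity:
  "continuous_on UNIV (\<lambda>z. velocity (fst z) (snd z) :: 'v)" (is "continuous_on _ ?f")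
proof (rule continuous_at_imp_continuous_on, rule ballI)
  fix z :: "(real^'d^'n) \<times> (real^'d^'n)"
  let ?b = "\<lambda>z' :: (real^'d^'n) \<times> (real^'d^'n).
    CARD('n) * C * (norm (fst z' - fst z) * norm (snd z') + norm (snd z' - snd z))"
  have "(?b \<longlongrightarrow> ?b z) (at z)" by (intro tendsto_intros)
  then have "(?b \<longlongrightarrow> 0) (at z)" by simp
  then have "((\<lambda>z'. velocity (fst z') (snd z') - velocity (fst z) (snd z)) \<longlongrightarrow> 0) (at z)"
    by (rule Lim_null_comparison[rotated]) (simp add: velocity_diff_bound)
  then show "isCont (\<lambda>z. velocity (fst z) (snd z)) z" unfolding isCont_def by (rule LIM_zero_cancel)
qed

text \<open>Both gradients differentiate the sum of v(x_j) paired with p_j with the field v frozen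
  at the velocity. The factor 1/2 disappears because the velocity enters the Hamiltonian as a
  square.\<close>

definition grad_x :: "real^'d^'n \<Rightarrow> real^'d^'n \<Rightarrow> real^'d^'n" where
  "grad_x x p = (\<chi> j. adjoint (blinfun_apply (D (velocity x p) (x $ j))) (p $ j))"

definition grad_p :: "real^'d^'n \<Rightarrow> real^'d^'n \<Rightarrow> real^'d^'n" where
  "grad_p x p = (\<chi> j. ev (velocity x p) (x $ j))"

text \<open>With \<open>v\<close> the velocity of the base point frozen, \<open>H = v \<bullet> velocity + |velocity - v|\<^sup>2 / 2 - |v|\<^sup>2 / 2\<close>:
  the first term is differentiable because \<open>v\<close> is, and the second one is of second order because
  the velocity is locally Lipschitz.\<close>

lemma hamiltonian_has_derivative:
  fixes x p :: "real^'d^'n"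
  shows "((\<lambda>z. hamiltonian K (fst z) (snd z)) has_derivative
      (\<lambda>h. fst h \<bullet> grad_x x p + snd h \<bullet> grad_p x p)) (at (x, p))"
proof -
  define v where "v = velocity x p"
  define r where "r z = (norm (velocity (fst z) (snd z) - v))\<^sup>2 / 2" for z :: "(real^'d^'n) \<times> (real^'d^'n)"
  define g where "g z = (\<Sum>j\<in>UNIV. ev v (fst z $ j) \<bullet> snd z $ j)" for z :: "(real^'d^'n) \<times> (real^'d^'n)"
  \<comment> \<open>Half the square of the constant in \<open>velocity_diff_bound\<close>. Once the
    increment is factored out, the remaining weight depends on the moving momentum and stays bounded
    near (x, p).\<close>
  define c where "c = (CARD('n) * C)\<^sup>2 / 2"
  have eq: "(\<lambda>z. hamiltonian K (fst z) (snd z)) = (\<lambda>z. g z + r z - (norm v)\<^sup>2 / 2)"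
    unfolding g_def r_def inner_velocity[symmetric] hamiltonian_eq
    by (simp add: fun_eq_iff power2_norm_eq_inner inner_diff_left inner_diff_right inner_commute field_simps)
  have dg: "(g has_derivative (\<lambda>h. \<Sum>j\<in>UNIV. ev v (x $ j) \<bullet> snd h $ j + D v (x $ j) (fst h $ j) \<bullet> p $ j))
      (at (x, p))"
  proof -
    have "((\<lambda>z. ev v (fst z $ j)) has_derivative (\<lambda>h. D v (x $ j) (fst h $ j))) (at (x, p))" for j
    proof -
      have "((\<lambda>z. fst z $ j) has_derivative (\<lambda>h. fst h $ j)) (at (x, p))"
        by (intro bounded_linear_imp_has_derivative
            bounded_linear_compose[OF bounded_linear_vec_nth bounded_linear_fst])
      from has_derivative_compose[OF this, of "ev v"] D[of v "x $ j"] show ?thesis by simp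
    qed
    moreover have "((\<lambda>z. snd z $ j) has_derivative (\<lambda>h. snd h $ j)) (at (x, p))" for j
      by (intro bounded_linear_imp_has_derivative
          bounded_linear_compose[OF bounded_linear_vec_nth bounded_linear_snd])
    ultimately have "((\<lambda>z. ev v (fst z $ j) \<bullet> snd z $ j) has_derivative
        (\<lambda>h. ev v (x $ j) \<bullet> snd h $ j + D v (x $ j) (fst h $ j) \<bullet> p $ j)) (at (x, p))" for j
      using has_derivative_inner[of "\<lambda>z. ev v (fst z $ j)" _ "(x, p)" UNIV "\<lambda>z. snd z $ j"] by simp
    then show ?thesis unfolding g_def by (intro has_derivative_sum)
  qed
  have dr: "(r has_derivative (\<lambda>h. 0)) (at (x, p))"
  proof (rule has_derivativeI_sandwich[of 1])
    show "((\<lambda>z. c * (norm (snd z) + 1)\<^sup>2 * norm (z - (x, p))) \<longlongrightarrow> 0) (at (x, p))"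
    proof -
      have "((\<lambda>z. c * (norm (snd z) + 1)\<^sup>2 * norm (z - (x, p)))
          \<longlongrightarrow> c * (norm (snd (x, p)) + 1)\<^sup>2 * norm ((x, p) - (x, p))) (at (x, p))"
        by (intro tendsto_intros)
      then show ?thesis by simp
    qed
    fix z assume "z \<noteq> (x, p)"
    then have nz: "0 < norm (z - (x, p))" by simp
    have n1: "norm (fst z - x) \<le> norm (z - (x, p))" and n2: "norm (snd z - p) \<le> norm (z - (x, p))"
      using norm_fst_le[of "fst z - x" "snd z - p"] norm_snd_le[of "snd z - p" "fst z - x"]
      by (cases z; simp)+
    have "norm (velocity (fst z) (snd z) - v)
        \<le> CARD('n) * C * (norm (fst z - x) * norm (snd z) + norm (snd z - p))"
      unfolding v_def by (rule velocity_diff_bound)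
    also have "\<dots> \<le> CARD('n) * C * (norm (z - (x, p)) * norm (snd z) + norm (z - (x, p)))"
      using n1 n2 C by (intro mult_left_mono add_mono mult_right_mono) auto
    finally have "(norm (velocity (fst z) (snd z) - v))\<^sup>2
        \<le> (CARD('n) * C * (norm (z - (x, p)) * norm (snd z) + norm (z - (x, p))))\<^sup>2"
      by (intro power_mono) auto
    then have "r z \<le> (CARD('n) * C * (norm (z - (x, p)) * norm (snd z) + norm (z - (x, p))))\<^sup>2 / 2"
      unfolding r_def by (rule divide_right_mono) simp
    also have "\<dots> = c * (norm (snd z) + 1)\<^sup>2 * norm (z - (x, p)) * norm (z - (x, p))"
      by (simp add: c_def power2_eq_square algebra_simps)
    finally have "r z \<le> c * (norm (snd z) + 1)\<^sup>2 * norm (z - (x, p)) * norm (z - (x, p))" .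
    moreover have "r (x, p) = 0" "0 \<le> r z" by (simp_all add: r_def v_def)
    ultimately show "norm (r z - r (x, p) - 0) / norm (z - (x, p))
        \<le> c * (norm (snd z) + 1)\<^sup>2 * norm (z - (x, p))"
      using nz by (simp add: divide_le_eq)
  qed auto
  \<comment> \<open>The adjoint moves the derivative of v from the increment onto p_j, which puts
    the differential into gradient form.\<close>
  have "(\<lambda>h. (\<Sum>j\<in>UNIV. ev v (x $ j) \<bullet> snd h $ j + D v (x $ j) (fst h $ j) \<bullet> p $ j) + 0 - 0)
      = (\<lambda>h. fst h \<bullet> grad_x x p + snd h \<bullet> grad_p x p)"
    unfolding inner_vec_def[where 'a = "real^'d"] grad_x_def grad_p_def v_def[symmetric]
    by (simp add: fun_eq_iff sum.distrib adjoint_works bounded_linear.linear[OF blinfun.bounded_linear_right]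
        inner_commute)
  then show ?thesis
    unfolding eq using has_derivative_diff[OF has_derivative_add[OF dg dr] has_derivative_const, of "(norm v)\<^sup>2 / 2"] by simp
qed

section \<open>Growth and continuity of the gradients\<close>

lemma grad_p_bound:
  fixes x p :: "real^'d^'n"
  shows "norm (grad_p x p) \<le> CARD('n) * C * norm (velocity x p)"
proof -
  have "norm (grad_p x p) \<le> (\<Sum>j\<in>(UNIV::'n set). C * norm (velocity x p))"
    by (rule order_trans[OF norm_vec_le_sum sum_mono]) (simp add: grad_p_def ev_bound)
  then show ?thesis by simp
qed

lemma grad_x_bound:
  fixes x p :: "real^'d^'n"
  shows "norm (grad_x x p) \<le> CARD('n) * C * norm (velocity x p) * norm p"
proof -
  have "norm (grad_x x p) \<le> (\<Sum>j\<in>(UNIV::'n set). C * norm (velocity x p) * norm p)"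
  proof (rule order_trans[OF norm_vec_le_sum sum_mono])
    fix j
    have "norm (grad_x x p $ j) \<le> norm (D (velocity x p) (x $ j)) * norm (p $ j)"
      by (simp add: grad_x_def norm_adjoint_blinfun_le)
    also have "\<dots> \<le> C * norm (velocity x p) * norm p"
      using C by (intro mult_mono D_bound Finite_Cartesian_Product.norm_nth_le) auto
    finally show "norm (grad_x x p $ j) \<le> C * norm (velocity x p) * norm p" .
  qed
  then show ?thesis by simp
qed

lemma continuous_on_grad_p: "continuous_on UNIV (\<lambda>z. grad_p (fst z) (snd z))"
  unfolding grad_p_def
  by (intro continuous_on_vec_lambda continuous_on_ev continuous_on_velocity continuous_intros)

lemma continuous_on_grad_x: "continuous_on UNIV (\<lambda>z. grad_x (fst z) (snd z))"
  unfolding grad_x_def adjoint_basis_sum[OF bounded_linear.linear[OF blinfun.bounded_linear_right]]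
  by (intro continuous_on_vec_lambda continuous_intros continuous_on_ev continuous_on_velocity)

text \<open>\<open>gradient\<close> is a definite description, so its value must be backed by
  differentiability; the joint derivative restricted to the slices through (x, p) supplies
  it.\<close>

lemma gradient_hamiltonian:
  fixes x p :: "real^'d^'n"
  shows "gradient (\<lambda>p'. hamiltonian K x p') p = grad_p x p"
    and "gradient (\<lambda>x'. hamiltonian K x' p) x = grad_x x p"
proof -
  have "((\<lambda>p'. (x, p')) has_derivative (\<lambda>h. (0, h))) (at p)"
    "((\<lambda>x'. (x', p)) has_derivative (\<lambda>h. (h, 0))) (at x)"
    by (auto intro!: derivative_eq_intros)
  from this[THEN has_derivative_compose, OF hamiltonian_has_derivative]
  show "gradient (\<lambda>p'. hamiltonian K x p') p = grad_p x p"
    "gradient (\<lambda>x'. hamiltonian K x' p) x = grad_x x p"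
    by (auto intro!: gradient_eqI simp: gderiv_def)
qed

end

text \<open>In the constant, \<open>CARD('n)\<close> comes from bounding a vector by the sum of its
  components, \<open>C\<close> from the embedding and \<open>sqrt 2\<close> from the 1/2 in the
  Hamiltonian.\<close>

lemma (in embedded_rkhs) bounded_hamiltonian:
  "bounded_hamiltonian (hamiltonian K :: real^'d^'n \<Rightarrow> _) grad_x grad_p (sqrt 2 * CARD('n) * C)"
proof
  fix x p :: "real^'d^'n"
  show "0 < sqrt 2 * CARD('n) * C" using C by simp
  show "0 \<le> hamiltonian K x p" by (simp add: hamiltonian_eq)
  show "norm (grad_p x p) \<le> sqrt 2 * CARD('n) * C * sqrt (hamiltonian K x p)"
    using grad_p_bound[of x p] by (simp add: norm_velocity mult_ac)
  show "norm (grad_x x p) \<le> sqrt 2 * CARD('n) * C * sqrt (hamiltonian K x p) * norm p"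
    using grad_x_bound[of x p] by (simp add: norm_velocity mult_ac)
qed (rule hamiltonian_has_derivative continuous_on_grad_x continuous_on_grad_p)+

section \<open>Square-integrable controls\<close>

lemma integrable_lebesgue_on_iff_absolutely_integrable:
  fixes f :: "'a::euclidean_space \<Rightarrow> 'b::euclidean_space"
  assumes "S \<in> sets lebesgue"
  shows "integrable (lebesgue_on S) f \<longleftrightarrow> f absolutely_integrable_on S"
  using assms by (simp add: integrable_restrict_space set_integrable_def)

text \<open>On a set of finite measure the constant 1 is integrable, and |u| is dominated by 1 +
  |u|^2.\<close>

lemma L2_control_integrable:
  fixes u :: "real \<Rightarrow> 'a::euclidean_space"
  assumes u: "u \<in> L2_control T"
  shows "integrable (lebesgue_on {0..T}) u"
proof (rule Bochner_Integration.integrable_bound)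
  show "integrable (lebesgue_on {0..T}) (\<lambda>s. 1 + (norm (u s))\<^sup>2)"
    using u by (intro Bochner_Integration.integrable_add) (auto simp: L2_control_def)
  show "u \<in> borel_measurable (lebesgue_on {0..T})" using u by (simp add: L2_control_def)
  have "norm (u s) \<le> 1 + (norm (u s))\<^sup>2" for s
  proof -
    have "2 * norm (u s) \<le> 1 + (norm (u s))\<^sup>2"
      using zero_le_power2[of "norm (u s) - 1"] unfolding power2_diff by simp
    then show ?thesis using norm_ge_zero[of "u s"] by linarith
  qed
  then show "AE s in lebesgue_on {0..T}. norm (u s) \<le> norm (1 + (norm (u s))\<^sup>2)"
    by (intro AE_I2) (metis abs_ge_self order_trans real_norm_def)
qed

text \<open>Nonnegativity of the variance of |u| about its mean W / T.\<close>

lemma L2_control_Cauchy_Schwarz: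
  fixes u :: "real \<Rightarrow> 'a::euclidean_space"
  assumes T: "0 < T" and u: "u \<in> L2_control T"
  shows "(LINT s|lebesgue_on {0..T}. norm (u s))\<^sup>2 \<le> T * (LINT s|lebesgue_on {0..T}. (norm (u s))\<^sup>2)"
proof -
  let ?M = "lebesgue_on {0..T}"
  define W where "W = (LINT s|?M. norm (u s))"
  have i1: "integrable ?M (\<lambda>s. norm (u s))"
    by (intro integrable_norm L2_control_integrable u)
  have i2: "integrable ?M (\<lambda>s. (norm (u s))\<^sup>2)" using u by (simp add: L2_control_def)
  have "0 \<le> (LINT s|?M. (norm (u s) - W / T)\<^sup>2)" by simp
  also have "\<dots> = (LINT s|?M. (norm (u s))\<^sup>2 - 2 * (W / T) * norm (u s) + (W / T)\<^sup>2)"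
    by (simp add: power2_diff algebra_simps)
  also have "\<dots> = (LINT s|?M. (norm (u s))\<^sup>2) - 2 * (W / T) * W + T * (W / T)\<^sup>2"
    using T i1 i2 by (simp add: W_def measure_restrict_space)
  also have "\<dots> = (LINT s|?M. (norm (u s))\<^sup>2) - W\<^sup>2 / T"
    using T by (simp add: power2_eq_square field_simps)
  finally have "W\<^sup>2 / T \<le> (LINT s|?M. (norm (u s))\<^sup>2)" by simp
  then show ?thesis using T by (simp add: W_def divide_le_eq mult.commute)
qed

section \<open>Choice of the constants and passage to Lebesgue integrals\<close>

theorem proposition2:
  fixes ev :: "'v::{real_inner,complete_space} \<Rightarrow> real^'d \<Rightarrow> real^'d"
    and K :: "real^'d \<Rightarrow> real^'d \<Rightarrow> real^'d^'d"
    and T :: real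
  assumes "T > 0"
    and "vector_field_space ev"
    and "continuously_embedded_C1 ev"
    and "reproducing_kernel ev K"
    and "C2_in_each_variable K"
  shows "\<exists>C1>0. \<exists>C2>0. \<exists>C3>0.
    \<forall>u \<in> L2_control T. \<forall>(x0 :: real^'d^'n) (p0 :: real^'d^'n). \<exists>x p.
      controlled_hamiltonian_solution K T u x0 p0 x p \<and>
      (let HT = C1 * (hamiltonian K x0 p0 + T * (LINT s|lebesgue_on {0..T}. (norm (u s))\<^sup>2))
       in \<forall>t\<in>{0..T}.
            hamiltonian K (x t) (p t) \<le> HT \<and>
            norm (x t) \<le> norm x0 + C2 * T * sqrt HT \<and>
            norm (p t) \<le> (norm p0 + (LINT s|lebesgue_on {0..T}. norm (u s)))
                          * exp (C3 * T * sqrt HT))"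
proof -
  obtain C D where CD: "0 < C"
    "\<And>v z. (ev v has_derivative blinfun_apply (D v z)) (at z)"
    "\<And>v. continuous_on UNIV (D v)"
    "\<And>v z. norm (ev v z) \<le> C * norm v" "\<And>v z. norm (D v z) \<le> C * norm v"
    using embedding_bounds[OF assms(3)] by blast
  obtain k where k: "\<And>z \<alpha>. ev (k z \<alpha>) = (\<lambda>y. K y z *v \<alpha>)" "\<And>v z \<alpha>. v \<bullet> k z \<alpha> = ev v z \<bullet> \<alpha>"
    using assms(4) unfolding reproducing_kernel_def by metis
  interpret embedded_rkhs ev K C D k
    by (rule embedded_rkhs.intro) (use CD k assms(2) in \<open>simp_all add: vector_field_space_def\<close>)
  define c where "c = sqrt 2 * CARD('n) * C"
  interpret H: bounded_hamiltonian "hamiltonian K :: real^'d^'n \<Rightarrow> _" grad_x grad_p c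
    unfolding c_def by (rule bounded_hamiltonian)
  \<comment> \<open>The speed and force bounds share the constant c, which serves as both C2 and C3.
    The value 2 + c^2 for C1 dominates the coefficients 2 and c^2 / 2 that appear when the bound on
    the root of the energy is squared. All three are fixed before u, x0 and p0.\<close>
  show ?thesis
  proof (rule exI[of _ "2 + c\<^sup>2"], rule conjI, simp add: add_pos_nonneg,
      rule exI[of _ c], rule conjI[OF H.c_pos], rule exI[of _ c], rule conjI[OF H.c_pos],
      intro ballI allI)
    fix u :: "real \<Rightarrow> real^'d^'n" and x0 p0 :: "real^'d^'n"
    assume u: "u \<in> L2_control T"
    define I where "I = (LINT s|lebesgue_on {0..T}. (norm (u s))\<^sup>2)"
    define W where "W = (LINT s|lebesgue_on {0..T}. norm (u s))"
    define HT where "HT = (2 + c\<^sup>2) * (hamiltonian K x0 p0 + T * I)"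
    have ui: "u absolutely_integrable_on {0..T}"
      using L2_control_integrable[OF u] by (simp add: integrable_lebesgue_on_iff_absolutely_integrable)
    have W_eq: "integral {0..T} (\<lambda>s. norm (u s)) = W"
      unfolding W_def using L2_control_integrable[OF u]
      by (subst lebesgue_integral_eq_integral) auto
    have I0: "0 \<le> I" by (simp add: I_def)
    have h0: "0 \<le> hamiltonian K x0 p0" by (rule H.H_nonneg)
    have B: "sqrt (hamiltonian K x0 p0) + c / 2 * integral {0..T} (\<lambda>s. norm (u s)) \<le> sqrt HT"
    proof (rule real_le_rsqrt)
      define a where "a = sqrt (hamiltonian K x0 p0)"
      \<comment> \<open>The square of a sum is at most twice the sum of the squares; Cauchy-Schwarz
        then replaces W^2 by T * I.\<close>
      have "(a + c / 2 * W)\<^sup>2 \<le> 2 * a\<^sup>2 + c\<^sup>2 * W\<^sup>2 / 2"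
        using zero_le_power2[of "a - c / 2 * W"] by (simp add: power2_eq_square algebra_simps)
      also have "\<dots> \<le> 2 * hamiltonian K x0 p0 + c\<^sup>2 * (T * I) / 2"
        using L2_control_Cauchy_Schwarz[OF assms(1) u] h0
        by (intro add_mono divide_right_mono mult_left_mono) (auto simp: W_def I_def a_def)
      also have "\<dots> \<le> HT"
        using assms(1) I0 h0 by (simp add: HT_def algebra_simps)
      finally show "(sqrt (hamiltonian K x0 p0) + c / 2 * integral {0..T} (\<lambda>s. norm (u s)))\<^sup>2 \<le> HT"
        by (simp add: a_def W_eq)
    qed
    have HT0: "0 \<le> HT" using assms(1) I0 h0 by (simp add: HT_def)
    obtain x p where x_cont: "continuous_on {0..T} x" and p_cont: "continuous_on {0..T} p"
      and x: "\<And>t. t \<in> {0..T} \<Longrightarrow> x t = x0 + integral {0..t} (\<lambda>s. grad_p (x s) (p s))"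
      and p: "\<And>t. t \<in> {0..T} \<Longrightarrow> p t = p0 + integral {0..t} (\<lambda>s. - grad_x (x s) (p s) + u s)"
      and bH: "\<And>t. t \<in> {0..T} \<Longrightarrow> sqrt (hamiltonian K (x t) (p t)) \<le> sqrt HT"
      and bx: "\<And>t. t \<in> {0..T} \<Longrightarrow> norm (x t) \<le> norm x0 + c * sqrt HT * t"
      and bp: "\<And>t. t \<in> {0..T} \<Longrightarrow> norm (p t) \<le> (norm p0 + W) * exp (c * sqrt HT * t)"
      using H.controlled_trajectory_exists[OF less_imp_le[OF assms(1)] ui B] unfolding W_eq by blast
    have sol: "controlled_hamiltonian_solution K T u x0 p0 x p"
      unfolding controlled_hamiltonian_solution_def gradient_hamiltonian
    proof (intro conjI ballI)
      show "continuous_on {0..T} (\<lambda>t. (x t, p t))" by (intro continuous_intros x_cont p_cont)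
      fix t assume t: "t \<in> {0..T}"
      then have sub: "{0..t} \<subseteq> {0..T}" by auto
      have S: "{0..t} \<in> sets lebesgue" by simp
      \<comment> \<open>The trajectory was built with gauge integrals, whereas a solution is defined
        through Lebesgue integrals; the two agree for absolutely integrable functions.\<close>
      have G: "(\<lambda>s. grad_x (x s) (p s)) absolutely_integrable_on {0..t}"
        "(\<lambda>s. grad_p (x s) (p s)) absolutely_integrable_on {0..t}"
        by (intro absolutely_integrable_continuous_real H.continuous_on_G
            continuous_on_subset[OF x_cont sub] continuous_on_subset[OF p_cont sub])+
      show i1: "integrable (lebesgue_on {0..t}) (\<lambda>s. grad_p (x s) (p s))"
        using G(2) by (simp add: integrable_lebesgue_on_iff_absolutely_integrable)
      show i2: "integrable (lebesgue_on {0..t}) (\<lambda>s. - grad_x (x s) (p s) + u s)"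
        using G(1) absolutely_integrable_on_subinterval[OF ui sub]
        by (intro Bochner_Integration.integrable_add Bochner_Integration.integrable_minus)
          (simp_all add: integrable_lebesgue_on_iff_absolutely_integrable)
      show "x t = x0 + (LINT s|lebesgue_on {0..t}. grad_p (x s) (p s))"
        unfolding lebesgue_integral_eq_integral[OF i1 S] by (rule x[OF t])
      show "p t = p0 + (LINT s|lebesgue_on {0..t}. - grad_x (x s) (p s) + u s)"
        unfolding lebesgue_integral_eq_integral[OF i2 S] by (rule p[OF t])
    qed
    have W0: "0 \<le> norm p0 + W" by (simp add: W_def)
    have "hamiltonian K (x t) (p t) \<le> HT \<and> norm (x t) \<le> norm x0 + c * T * sqrt HT \<and>
        norm (p t) \<le> (norm p0 + W) * exp (c * T * sqrt HT)" if t: "t \<in> {0..T}" for t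
    proof (intro conjI)
      have *: "c * sqrt HT * t \<le> c * T * sqrt HT"
        using t H.c_pos HT0 by (simp add: mult.assoc mult.commute[of _ "sqrt HT"] mult_left_mono)
      show "hamiltonian K (x t) (p t) \<le> HT" using bH[OF t] by simp
      show "norm (x t) \<le> norm x0 + c * T * sqrt HT" using bx[OF t] * by linarith
      have "(norm p0 + W) * exp (c * sqrt HT * t) \<le> (norm p0 + W) * exp (c * T * sqrt HT)"
        using * W0 by (intro mult_left_mono) auto
      then show "norm (p t) \<le> (norm p0 + W) * exp (c * T * sqrt HT)" using bp[OF t] by linarith
    qed
    then show "\<exists>x p. controlled_hamiltonian_solution K T u x0 p0 x p \<and>
      (let HT = (2 + c\<^sup>2) * (hamiltonian K x0 p0 + T * (LINT s|lebesgue_on {0..T}. (norm (u s))\<^sup>2))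
       in \<forall>t\<in>{0..T}.
            hamiltonian K (x t) (p t) \<le> HT \<and>
            norm (x t) \<le> norm x0 + c * T * sqrt HT \<and>
            norm (p t) \<le> (norm p0 + (LINT s|lebesgue_on {0..T}. norm (u s)))
                          * exp (c * T * sqrt HT))"
      unfolding Let_def I_def[symmetric] W_def[symmetric] HT_def[symmetric] using sol by blast
  qed
qed

end
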